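(* Let $E$ be a Banach space and $\langle\cdot,\cdot\rangle$ a continuous scalar product on $E$. Let $G$ be a Lie group and $\Phi$ a $G$-action on $E$. Let $F\in C^2(E,\mathbb R^m)$, $\mu_*\in\mathbb R^m$, $\Sigma_{\mu_*}=\{u\in E\mid F(u)=\mu_*\}$, $u_{\mu_*}\in\Sigma_{\mu_*}$, $G_{\Sigma_{\mu_*}}=\{g\in G\mid\Phi_g\Sigma_{\mu_*}=\Sigma_{\mu_*}\}$ and $\mathcal O_{u_{\mu_*}}=\{\Phi_g(u_{\mu_*})\mid g\in G_{\Sigma_{\mu_*}}\}$. Let $\mathcal L_{\mu_*}\in C^2(E,\mathbb R)$ be a $G_{\Sigma_{\mu_*}}$-invariant function. Suppose that: (C-i) for all $g\in G$, $\Phi_g$ is linear and preserves both $\langle\cdot,\cdot\rangle$ and the norm $\|\cdot\|$; (C-ii) $\mathrm{Ad}_g^*$ is orthogonal for all $g\in G_{\Sigma_{\mu_*}}$; (C-iii) $\mu_*$ is a regular value of $F$; (C-iv) $u_{\mu_*}$ is a $C^1$-vector for $\Phi$, and the map $\xi\in\mathfrak g_{\Sigma_{\mu_*}}\mapsto\Phi_{\exp(\xi)}u_{\mu_*}\in E$ is one to one in a neighbourhood of $\xi=0$. Suppose moreover that for all $u\in\mathcal O_{u_{\mu_*}}$ and all $j=1,\dots,m$ there exists $\nabla F_j(u)\in E$ such that $D_uF_j(w)=\langle\nabla F_j(u),w\rangle$ for all $w\in E$. Suppose finally that: (a) $D_u\mathcal L_{\mu_*}(w)=0$ for all $u\in\mathcal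 O_{u_{\mu_*}}$ and $w\in E$; (b) there exists $C>0$ such that $D^2_u\mathcal L_{\mu_*}(w,w)\le C\|w\|^2$ for all $u\in\mathcal O_{u_{\mu_*}}$ and $w\in E$; (c) there exists $c>0$ such that $$\forall u\in\mathcal O_{u_{\mu_*}},\ \forall w\in T_u\Sigma_{\mu_*}\cap(T_u\mathcal O_{u_{\mu_*}})^\perp,\quad D^2_u\mathcal L_{\mu_*}(w,w)\ge c\|w\|^2.$$ Then there exist $\eta>0$, $\tilde c>0$ such that $$\forall u\in\mathcal O_{u_{\mu_*}},\ \forall u'\in\Sigma_{\mu_*},\quad \mathrm d(u,u')\le\eta\ \Rightarrow\ \mathcal L_{\mu_*}(u')-\mathcal L_{\mu_*}(u)\ge\tilde c\,\mathrm d^2(u',\mathcal O_{u_{\mu_*}}).$$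
   Context: $E$ is a real Banach space with norm $\|\cdot\|$; $\mathrm d(u,v)=\|u-v\|$, $\mathrm d(u,S)=\inf_{v\in S}\mathrm d(u,v)$. A continuous scalar product on $E$ is an inner product $\langle\cdot,\cdot\rangle$ with $|\langle v,w\rangle|\le\|v\|\,\|w\|$ for all $v,w\in E$; $E$ need not be complete for it. An action $\Phi$ of $G$ on $E$ is a separately continuous map $(g,u)\mapsto\Phi_g(u)$ with $\Phi_e=\mathrm{Id}$, $\Phi_{g_1g_2}=\Phi_{g_1}\circ\Phi_{g_2}$. A Lie group is understood as a matrix Lie group, with Lie algebra $\mathfrak g$. $G_{\Sigma_{\mu_*}}$ is a Lie subgroup with Lie algebra $\mathfrak g_{\Sigma_{\mu_*}}$. The coadjoint action on $\mathfrak g^*$ is $(\mathrm{Ad}^*_g\mu)(\xi)=\mu(\mathrm{Ad}_{g^{-1}}\xi)$. "$\mathrm{Ad}^*_g$ is orthogonal" (written $\mathrm{Ad}^*_g\in\mathrm O(m)$ in the paper) means: there is a fixed basis of $\mathfrak g$ such that, for all the $g$ in question, the matrix of $\mathrm{Ad}_g$ in this basis (equivalently of $\mathrm{Ad}_g^*$ in the dual basis) is orthogonal, i.e. there is a Euclidean structure on $\mathfrak g$ preserved by these $\mathrm{Ad}_g$. $u\in E$ is a $C^1$-vector for $\Phi$ if $g\in G\mapsto\Phi_g(u)\in E$ is $C^1$. $\mu_*$ is a regular value of $F$ if $\Sigma_{\mu_*}\neq\emptyset$ and $D_uF:E\to\mathbb R^m$ is surjective for all $u\in\Sigma_{\mu_*}$;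 $T_u\Sigma_{\mu_*}=\ker D_uF$. For $u\in\mathcal O_{u_{\mu_*}}$: $T_u\mathcal O_{u_{\mu_*}}=\{X_\xi(u)\mid\xi\in\mathfrak g_{\Sigma_{\mu_*}}\}$, where $X_\xi(u)=\frac{\mathrm d}{\mathrm dt}\Phi_{\exp(t\xi)}(u)|_{t=0}$, and $(T_u\mathcal O_{u_{\mu_*}})^\perp=\{z\in E\mid\langle z,y\rangle=0\ \forall y\in T_u\mathcal O_{u_{\mu_*}}\}$. *)

theory Defs
  imports "HOL-Analysis.Analysis"
begin

section \<open>Differential calculus on normed spaces\<close>

definition fderiv :: "('a::real_normed_vector \<Rightarrow> 'b::real_normed_vector) \<Rightarrow> 'a \<Rightarrow> 'a \<Rightarrow>\<^sub>L 'b"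
  where "fderiv f u = Blinfun (frechet_derivative f (at u))"

text \<open>The set \<open>S\<close> is meant to be open. Continuity of the derivative is with respect to the
  operator norm.\<close>

definition C1_on :: "'a::real_normed_vector set \<Rightarrow> ('a \<Rightarrow> 'b::real_normed_vector) \<Rightarrow> bool"
  where "C1_on S f \<longleftrightarrow> (\<forall>u\<in>S. f differentiable (at u)) \<and> continuous_on S (fderiv f)"

definition C2 :: "('a::real_normed_vector \<Rightarrow> 'b::real_normed_vector) \<Rightarrow> bool"
  where "C2 f \<longleftrightarrow> (\<forall>u. f differentiable (at u)) \<and> C1_on UNIV (fderiv f)"

definition D1 :: "('a::real_normed_vector \<Rightarrow> 'b::real_normed_vector) \<Rightarrow> 'a \<Rightarrow> 'a \<Rightarrow> 'b"
  where "D1 f u = frechet_derivative f (at u)"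

definition D2 :: "('a::real_normed_vector \<Rightarrow> 'b::real_normed_vector) \<Rightarrow> 'a \<Rightarrow> 'a \<Rightarrow> 'a \<Rightarrow> 'b"
  where "D2 f u v w = blinfun_apply (blinfun_apply (fderiv (fderiv f) u) v) w"

definition regular_value :: "('a::real_normed_vector \<Rightarrow> 'b::real_normed_vector) \<Rightarrow> 'b \<Rightarrow> bool"
  where "regular_value F \<mu> \<longleftrightarrow> (\<exists>u. F u = \<mu>) \<and> (\<forall>u. F u = \<mu> \<longrightarrow> surj (D1 F u))"

definition tangent_level :: "('a::real_normed_vector \<Rightarrow> 'b::real_normed_vector) \<Rightarrow> 'a \<Rightarrow> 'a set"
  where "tangent_level F u = {w. D1 F u w = 0}"

definition continuous_scalar_product :: "('e::real_normed_vector \<Rightarrow> 'e \<Rightarrow> real) \<Rightarrow> bool"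
  where "continuous_scalar_product ip \<longleftrightarrow>
    bilinear ip \<and> (\<forall>v w. ip v w = ip w v) \<and> (\<forall>v. v \<noteq> 0 \<longrightarrow> ip v v > 0) \<and>
    (\<forall>v w. \<bar>ip v w\<bar> \<le> norm v * norm w)"

definition ortho_compl :: "('e \<Rightarrow> 'e \<Rightarrow> real) \<Rightarrow> 'e set \<Rightarrow> 'e set"
  where "ortho_compl ip T = {z. \<forall>y\<in>T. ip z y = 0}"

section \<open>Matrix Lie groups\<close>

text \<open>On \<open>complex ^ 'n ^ 'n\<close> the type class operations \<open>*\<close> and \<open>^\<close> act componentwise (and so
  would any exponential built on them), so powers and the exponential are defined here from the
  matrix product \<open>**\<close>.\<close>

type_synonym 'n cmatrix = "complex ^ 'n ^ 'n"

definition mpow :: "'n::finite cmatrix \<Rightarrow> nat \<Rightarrow> 'n cmatrix"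
  where "mpow A k = (((**) A) ^^ k) (mat 1)"

definition mexp :: "'n::finite cmatrix \<Rightarrow> 'n cmatrix"
  where "mexp A = (\<Sum>k. (1 / fact k) *\<^sub>R mpow A k)"

text \<open>A matrix Lie group is a subgroup of the general linear group that is closed in the
  general linear group (not necessarily in the space of all matrices).\<close>

definition matrix_Lie_group :: "'n::finite cmatrix set \<Rightarrow> bool"
  where "matrix_Lie_group G \<longleftrightarrow>
    mat 1 \<in> G \<and> (\<forall>g\<in>G. \<forall>h\<in>G. g ** h \<in> G) \<and> (\<forall>g\<in>G. matrix_inv g \<in> G) \<and>
    closedin (top_of_set {A. invertible A}) G"

definition Lie_algebra :: "'n::finite cmatrix set \<Rightarrow> 'n cmatrix set"
  where "Lie_algebra G = {\<xi>. \<forall>t::real. mexp (t *\<^sub>R \<xi>) \<in> G}"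

definition Ad :: "'n::finite cmatrix \<Rightarrow> 'n cmatrix \<Rightarrow> 'n cmatrix"
  where "Ad g \<xi> = g ** \<xi> ** matrix_inv g"

definition coAd :: "'n::finite cmatrix \<Rightarrow> ('n cmatrix \<Rightarrow> real) \<Rightarrow> 'n cmatrix \<Rightarrow> real"
  where "coAd g \<mu> \<xi> = \<mu> (Ad (matrix_inv g) \<xi>)"

text \<open>If \<open>B\<close> is a basis of the (real) Lie algebra, its dual basis consists of the coordinate
  functionals \<open>\<lambda>\<xi>. representation B \<xi> b\<close>, and the coordinate at \<open>a\<close> of a functional in the dual basis
  is its value at \<open>a\<close>.\<close>

definition coAd_matrix :: "'n::finite cmatrix set \<Rightarrow> 'n cmatrix \<Rightarrow> 'n cmatrix \<Rightarrow> 'n cmatrix \<Rightarrow> real"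
  where "coAd_matrix B g a b = coAd g (\<lambda>\<xi>. representation B \<xi> b) a"

text \<open>One basis has to serve all \<open>g \<in> H\<close>.\<close>

definition coAd_orthogonal :: "'n::finite cmatrix set \<Rightarrow> 'n cmatrix set \<Rightarrow> bool"
  where "coAd_orthogonal G H \<longleftrightarrow>
    (\<exists>B. independent B \<and> span B = Lie_algebra G \<and>
      (\<forall>g\<in>H. \<forall>a\<in>B. \<forall>b\<in>B.
        (\<Sum>c\<in>B. coAd_matrix B g c a * coAd_matrix B g c b) = (if a = b then 1 else 0)))"

section \<open>Actions\<close>

definition Lie_action ::
    "'n::finite cmatrix set \<Rightarrow> ('n cmatrix \<Rightarrow> 'e::real_normed_vector \<Rightarrow> 'e) \<Rightarrow> bool"
  where "Lie_action G \<Phi> \<longleftrightarrow>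
    (\<forall>g\<in>G. continuous_on UNIV (\<Phi> g)) \<and> (\<forall>u. continuous_on G (\<lambda>g. \<Phi> g u)) \<and>
    \<Phi> (mat 1) = id \<and> (\<forall>g\<in>G. \<forall>h\<in>G. \<Phi> (g ** h) = \<Phi> g \<circ> \<Phi> h)"

definition set_stabilizer ::
    "'n::finite cmatrix set \<Rightarrow> ('n cmatrix \<Rightarrow> 'e \<Rightarrow> 'e) \<Rightarrow> 'e set \<Rightarrow> 'n cmatrix set"
  where "set_stabilizer G \<Phi> S = {g \<in> G. \<Phi> g ` S = S}"

definition group_orbit ::
    "'n::finite cmatrix set \<Rightarrow> ('n cmatrix \<Rightarrow> 'e \<Rightarrow> 'e) \<Rightarrow> 'e \<Rightarrow> 'e set"
  where "group_orbit H \<Phi> u = {\<Phi> g u | g. g \<in> H}"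

text \<open>Since \<open>G\<close> is an embedded submanifold of the space of matrices, a map on \<open>G\<close> is \<open>C\<^sup>1\<close> iff
  it extends locally, near every point of \<open>G\<close>, to a \<open>C\<^sup>1\<close> map on an open set of matrices.\<close>

definition C1_vector ::
    "'n::finite cmatrix set \<Rightarrow> ('n cmatrix \<Rightarrow> 'e::real_normed_vector \<Rightarrow> 'e) \<Rightarrow> 'e \<Rightarrow> bool"
  where "C1_vector G \<Phi> u \<longleftrightarrow>
    (\<forall>g\<in>G. \<exists>U f. open U \<and> g \<in> U \<and> C1_on U f \<and> (\<forall>h\<in>G \<inter> U. f h = \<Phi> h u))"

definition generator ::
    "('n::finite cmatrix \<Rightarrow> 'e::real_normed_vector \<Rightarrow> 'e) \<Rightarrow> 'n cmatrix \<Rightarrow> 'e \<Rightarrow> 'e"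
  where "generator \<Phi> \<xi> u = vector_derivative (\<lambda>t. \<Phi> (mexp (t *\<^sub>R \<xi>)) u) (at 0)"

definition tangent_orbit ::
    "'n::finite cmatrix set \<Rightarrow> ('n cmatrix \<Rightarrow> 'e::real_normed_vector \<Rightarrow> 'e) \<Rightarrow> 'e \<Rightarrow> 'e set"
  where "tangent_orbit H \<Phi> u = {generator \<Phi> \<xi> u | \<xi>. \<xi> \<in> Lie_algebra H}"

end

theory Submission
  imports Defs
begin

text \<open>By invariance it suffices to treat the base point \<open>u\<mu>\<close>. For \<open>u'\<close> close to it, minimise the
  scalar product distance from \<open>u'\<close> to \<open>\<Phi> g u\<mu>\<close> over the elements \<open>g\<close> of the stabilizer \<open>H\<close> near the
  identity. At a minimiser, \<open>v = \<Phi> (matrix_inv g) u'\<close> lies on the level set and \<open>v - u\<mu>\<close> is orthogonal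
  to the tangent space of the orbit. Up to a correction of order \<open>o (norm (v - u\<mu>))\<close> along the
  gradients of \<open>F\<close>, which are orthogonal to the orbit, \<open>v - u\<mu>\<close> is also tangent to the level set, so
  the coercivity of the second derivative and Taylor's formula bound \<open>L v - L u\<mu>\<close> from below by a
  multiple of the square of \<open>norm (v - u\<mu>)\<close>, which is the distance from \<open>u'\<close> to a point of the orbit.

  That the minimum is attained away from the boundary follows from the discreteness of the isotropy
  group of \<open>u\<mu>\<close> in \<open>H\<close>: a closed matrix group in which the identity is not isolated contains a
  one-parameter subgroup, which injectivity of \<open>\<xi> \<mapsto> \<Phi> (mexp \<xi>) u\<mu>\<close> near \<open>0\<close> rules out.\<close>

section \<open>The matrix exponential\<close>

lemma norm_matrix_power2: "(norm (A :: 'n::finite cmatrix))\<^sup>2 = (\<Sum>i\<in>UNIV. \<Sum>j\<in>UNIV. (norm (A $ i $ j))\<^sup>2)"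
  by (simp add: norm_vec_def L2_set_def sum_nonneg)

text \<open>By Cauchy-Schwarz each squared entry of the product is at most the squared norm of a row
  of \<open>A\<close> times that of a column of \<open>B\<close>; summed over all entries, this
  bound factors.\<close>

lemma norm_matrix_mult_le: "norm (A ** B) \<le> norm A * norm B" for A B :: "'n::finite cmatrix"
proof (rule power2_le_imp_le)
  have entry: "(norm ((A ** B) $ i $ j))\<^sup>2 \<le> (\<Sum>k\<in>UNIV. (norm (A $ i $ k))\<^sup>2) * (\<Sum>k\<in>UNIV. (norm (B $ k $ j))\<^sup>2)"
    for i j
  proof -
    have "norm ((A ** B) $ i $ j) \<le> (\<Sum>k\<in>UNIV. norm (A $ i $ k) * norm (B $ k $ j))"
      unfolding matrix_matrix_mult_def
      by simp (rule order_trans[OF norm_sum], simp add: norm_mult)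
    then have "(norm ((A ** B) $ i $ j))\<^sup>2 \<le> (\<Sum>k\<in>UNIV. norm (A $ i $ k) * norm (B $ k $ j))\<^sup>2"
      by (rule power_mono) simp
    also have "\<dots> \<le> (\<Sum>k\<in>UNIV. (norm (A $ i $ k))\<^sup>2) * (\<Sum>k\<in>UNIV. (norm (B $ k $ j))\<^sup>2)"
      by (rule Cauchy_Schwarz_ineq_sum)
    finally show ?thesis .
  qed
  have "(norm (A ** B))\<^sup>2 \<le> (\<Sum>i\<in>UNIV. \<Sum>j\<in>UNIV.
      (\<Sum>k\<in>UNIV. (norm (A $ i $ k))\<^sup>2) * (\<Sum>k\<in>UNIV. (norm (B $ k $ j))\<^sup>2))"
    unfolding norm_matrix_power2 by (intro sum_mono entry)
  also have "\<dots> = (\<Sum>i\<in>UNIV. \<Sum>k\<in>UNIV. (norm (A $ i $ k))\<^sup>2) * (\<Sum>j\<in>UNIV. \<Sum>k\<in>UNIV. (norm (B $ k $ j))\<^sup>2)"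
    by (rule sum_product[symmetric])
  also have "(\<Sum>j\<in>UNIV. \<Sum>k\<in>UNIV. (norm (B $ k $ j))\<^sup>2) = (norm B)\<^sup>2"
    unfolding norm_matrix_power2 by (rule sum.swap)
  finally show "(norm (A ** B))\<^sup>2 \<le> (norm A * norm B)\<^sup>2"
    by (simp add: norm_matrix_power2 power_mult_distrib)
qed simp

lemma bounded_bilinear_matrix_mult: "bounded_bilinear ((**) :: 'n::finite cmatrix \<Rightarrow> 'n cmatrix \<Rightarrow> 'n cmatrix)"
proof
  show "\<exists>K. \<forall>(a :: 'n cmatrix) (b :: 'n cmatrix). norm (a ** b) \<le> norm a * norm b * K"
    by (intro exI[of _ 1]) (simp add: norm_matrix_mult_le)
qed (simp_all add: matrix_matrix_mult_def vec_eq_iff algebra_simps sum.distrib scaleR_sum_right)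

interpretation matmul: bounded_bilinear "(**) :: 'n::finite cmatrix \<Rightarrow> 'n cmatrix \<Rightarrow> 'n cmatrix"
  by (rule bounded_bilinear_matrix_mult)

lemma matrix_inv_mult:
  assumes "invertible (A :: 'a::semiring_1 ^ 'n ^ 'm)"
  shows "A ** matrix_inv A = mat 1" "matrix_inv A ** A = mat 1"
  using someI_ex[of "\<lambda>A'. A ** A' = mat 1 \<and> A' ** A = mat 1"] assms
  unfolding invertible_def matrix_inv_def by auto

text \<open>A kernel vector \<open>x\<close> is copied into every column of a matrix
  \<open>X\<close>, so that submultiplicativity applies: \<open>X = - ((A - mat 1) ** X)\<close>
  forces \<open>X = 0\<close>.\<close>

lemma invertible_near_one:
  assumes "norm (A - mat 1 :: 'n::finite cmatrix) < 1"
  shows "invertible A"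
proof -
  have "x = 0" if "A *v x = 0" for x
  proof -
    define X :: "'n cmatrix" where "X = (\<chi> i j. x $ i)"
    have "A ** X = 0"
      using that by (simp add: X_def matrix_matrix_mult_def matrix_vector_mult_def vec_eq_iff)
    then have "norm X = norm ((A - mat 1) ** X)"
      by (simp add: matmul.diff_left)
    also have "\<dots> \<le> norm (A - mat 1) * norm X"
      by (rule norm_matrix_mult_le)
    finally have "(1 - norm (A - mat 1)) * norm X \<le> 0"
      by (simp add: algebra_simps)
    then have "X = 0"
      using assms by (simp add: mult_le_0_iff)
    then show "x = 0"
      by (simp add: X_def vec_eq_iff)
  qed
  then show ?thesis
    unfolding invertible_left_inverse matrix_left_invertible_ker by blast
qed

section \<open>Powers, the exponential series and its derivative at 0\<close>

lemma mpow_0 [simp]: "mpow A 0 = mat 1"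
  and mpow_Suc: "mpow A (Suc k) = A ** mpow A k"
  by (simp_all add: mpow_def)

lemma mpow_Suc2: "mpow A (Suc k) = mpow A k ** A"
  by (induction k) (simp_all add: mpow_Suc matrix_mul_assoc)

lemma mpow_mult_left_inverse:
  assumes "A ** B = mat 1"
  shows "mpow A k ** mpow B k = mat 1"
proof (induction k)
  case (Suc k)
  have "mpow A (Suc k) ** mpow B (Suc k) = mpow A k ** (A ** B) ** mpow B k"
    by (simp add: mpow_Suc[of B] mpow_Suc2[of A] matrix_mul_assoc)
  then show ?case
    by (simp add: assms Suc)
qed simp

text \<open>The factor \<open>norm (mat 1)\<close> comes from the exponent 0: the Frobenius norm of
  the identity is the square root of the dimension.\<close>

lemma norm_mpow_le: "norm (mpow A k) \<le> norm (mat 1 :: 'n::finite cmatrix) * norm (A :: 'n cmatrix) ^ k"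
proof (induction k)
  case (Suc k)
  have "norm (mpow A (Suc k)) \<le> norm A * norm (mpow A k)"
    unfolding mpow_Suc by (rule norm_matrix_mult_le)
  also have "\<dots> \<le> norm A * (norm (mat 1 :: 'n cmatrix) * norm A ^ k)"
    by (intro mult_left_mono Suc) simp
  finally show ?case
    by (simp add: mult_ac)
qed simp

lemma summable_mexp:
  fixes A :: "'n::finite cmatrix"
  shows "summable (\<lambda>k. (1 / fact k) *\<^sub>R mpow A k)"
proof (rule summable_comparison_test')
  show "summable (\<lambda>k. norm (mat 1 :: 'n cmatrix) * (norm A ^ k / fact k))"
    by (intro summable_mult) (use summable_exp[of "norm A"] in \<open>simp add: field_simps\<close>)
  show "norm ((1 / fact k) *\<^sub>R mpow A k) \<le> norm (mat 1 :: 'n cmatrix) * (norm A ^ k / fact k)" for k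
    using norm_mpow_le[of A k] by (simp add: divide_right_mono)
qed

lemma mexp_0 [simp]: "mexp 0 = mat 1"
proof -
  have "mpow (0 :: 'a cmatrix) k = (if k = 0 then mat 1 else 0)" for k
    by (cases k) (simp_all add: mpow_Suc)
  then have "(\<lambda>k. (1 / fact k) *\<^sub>R mpow (0 :: 'a cmatrix) k) = (\<lambda>k. if k = 0 then mat 1 else 0)"
    by auto
  then show ?thesis
    unfolding mexp_def by (simp, subst suminf_finite[of "{0}"]) auto
qed

text \<open>Every term from the second order on contributes a factor
  \<open>(norm A)\<^sup>2\<close>; replacing \<open>fact (k + 2)\<close> by \<open>fact k\<close>
  leaves the exponential series of \<open>norm A\<close>.\<close>

lemma norm_mexp_remainder_le:
  fixes A :: "'n::finite cmatrix"
  shows "norm (mexp A - mat 1 - A) \<le> norm (mat 1 :: 'n cmatrix) * exp (norm A) * (norm A)\<^sup>2"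
proof -
  let ?N = "norm (mat 1 :: 'n cmatrix)"
  define f where "f k = (1 / fact k) *\<^sub>R mpow A k" for k
  have "suminf f = (\<Sum>k. f (k + 2)) + (\<Sum>k<2. f k)"
    using summable_mexp[of A] unfolding f_def by (rule suminf_split_initial_segment)
  moreover have "mexp A = suminf f" "(\<Sum>k<2. f k) = mat 1 + A"
    by (simp_all add: mexp_def f_def[abs_def] mpow_Suc numeral_2_eq_2)
  ultimately have rem: "mexp A - mat 1 - A = (\<Sum>k. f (k + 2))"
    by simp
  have sums: "(\<lambda>k. norm A ^ k / fact k) sums exp (norm A)"
    using exp_converges[of "norm A"] by (simp add: field_simps)
  have bound: "norm (f (k + 2)) \<le> ?N * (norm A)\<^sup>2 * (norm A ^ k / fact k)" for k
  proof -
    have "norm (f (k + 2)) \<le> ?N * norm A ^ (k + 2) / fact (k + 2)"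
      using norm_mpow_le[of A "k + 2"] unfolding f_def by (simp add: divide_right_mono)
    also have "\<dots> \<le> ?N * norm A ^ (k + 2) / fact k"
      by (intro divide_left_mono fact_mono mult_nonneg_nonneg mult_pos_pos) simp_all
    finally show ?thesis
      by (simp add: power2_eq_square mult_ac)
  qed
  have "norm (\<Sum>k. f (k + 2)) \<le> (\<Sum>k. ?N * (norm A)\<^sup>2 * (norm A ^ k / fact k))"
    by (rule norm_suminf_le[OF bound]) (intro summable_mult sums_summable[OF sums])
  also have "\<dots> = ?N * (norm A)\<^sup>2 * exp (norm A)"
    unfolding sums_unique[OF sums] by (rule suminf_mult[OF sums_summable[OF sums]])
  finally show ?thesis
    by (simp add: rem mult_ac)
qed

lemma mexp_has_derivative_0: "(mexp has_derivative (\<lambda>X. X)) (at (0 :: 'n::finite cmatrix))"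
proof (rule has_derivativeI_sandwich[of 1])
  let ?N = "norm (mat 1 :: 'n cmatrix)"
  show "((\<lambda>A :: 'n cmatrix. ?N * exp (norm A) * norm A) \<longlongrightarrow> 0) (at 0)"
    by (auto intro!: tendsto_eq_intros)
  show "norm (mexp A - mexp 0 - (A - 0)) / norm (A - 0) \<le> ?N * exp (norm A) * norm A" 
    if "A \<noteq> 0" for A :: "'n cmatrix"
    using that norm_mexp_remainder_le[of A] by (simp add: field_simps power2_eq_square)
qed (auto simp: bounded_linear_ident)

lemma mexp_curve_has_vector_derivative:
  "((\<lambda>t. mexp (t *\<^sub>R \<xi>)) has_vector_derivative \<xi>) (at 0)" for \<xi> :: "'n::finite cmatrix"
proof -
  have "((\<lambda>t. t *\<^sub>R \<xi>) has_derivative (\<lambda>t. t *\<^sub>R \<xi>)) (at 0)"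
    by (auto intro!: derivative_eq_intros)
  then show ?thesis
    using has_derivative_compose[of "\<lambda>t. t *\<^sub>R \<xi>" "\<lambda>t. t *\<^sub>R \<xi>" 0 UNIV mexp "\<lambda>X. X"] mexp_has_derivative_0
    by (simp add: has_vector_derivative_def)
qed

section \<open>Convergence of powers of matrices near the identity to the exponential\<close>

lemma mpow_one_plus:
  fixes B :: "'n::finite cmatrix"
  shows "mpow (mat 1 + B) k = (\<Sum>j\<le>k. real (k choose j) *\<^sub>R mpow B j)"
proof (induction k)
  case (Suc k)
  have "mpow (mat 1 + B) (Suc k) = (\<Sum>j\<le>k. real (k choose j) *\<^sub>R mpow B j)
      + (\<Sum>j\<le>k. real (k choose j) *\<^sub>R mpow B (Suc j))"
    by (simp add: mpow_Suc Suc matmul.add_left matmul.sum_right matmul.scaleR_right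
        scaleR_add_right sum.distrib)
  \<comment> \<open>The added term vanishes because \<open>k choose Suc k = 0\<close>; it prepares
    the index shift and Pascal's rule.\<close>
  also have "(\<Sum>j\<le>k. real (k choose j) *\<^sub>R mpow B j) = (\<Sum>j\<le>Suc k. real (k choose j) *\<^sub>R mpow B j)"
    by simp
  also have "\<dots> = mat 1 + (\<Sum>j\<le>k. real (k choose Suc j) *\<^sub>R mpow B (Suc j))"
    by (subst sum.atMost_Suc_shift) simp
  also have "\<dots> + (\<Sum>j\<le>k. real (k choose j) *\<^sub>R mpow B (Suc j))
      = mat 1 + (\<Sum>j\<le>k. real (Suc k choose Suc j) *\<^sub>R mpow B (Suc j))"
    by (simp add: sum.distrib algebra_simps)
  also have "\<dots> = (\<Sum>j\<le>Suc k. real (Suc k choose j) *\<^sub>R mpow B j)"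
    by (subst sum.atMost_Suc_shift) simp
  finally show ?case .
qed simp

text \<open>This is the termwise limit in the binomial expansion of
  \<open>mpow (mat 1 + b n) (k n)\<close>. In the induction the new factor
  \<open>real (k n) *\<^sub>R b n - real j *\<^sub>R b n\<close> tends to \<open>X\<close>, as its
  second part tends to 0.\<close>

lemma choose_mpow_tendsto:
  fixes b :: "nat \<Rightarrow> 'n::finite cmatrix"
  assumes b: "b \<longlonglongrightarrow> 0" and kb: "(\<lambda>n. real (k n) *\<^sub>R b n) \<longlonglongrightarrow> X"
  shows "(\<lambda>n. real (k n choose j) *\<^sub>R mpow (b n) j) \<longlonglongrightarrow> (1 / fact j) *\<^sub>R mpow X j"
proof (induction j)
  case (Suc j)
  have choose: "real (k n choose Suc j) = (real (k n) - real j) / real (Suc j) * real (k n choose j)" for n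
  proof -
    have "Suc j * (k n choose Suc j) = (k n - j) * (k n choose j)"
      by (metis binomial_absorb_comp binomial_absorption)
    then have "real (Suc j) * real (k n choose Suc j) = real (k n - j) * real (k n choose j)"
      by (metis of_nat_mult)
    \<comment> \<open>For \<open>j > k n\<close> the truncated and the real difference disagree, but
      then the binomial coefficient is 0.\<close>
    also have "\<dots> = (real (k n) - real j) * real (k n choose j)"
      by (cases "j \<le> k n") (simp_all add: of_nat_diff)
    finally show ?thesis
      by (simp add: field_simps)
  qed
  have "(\<lambda>n. (1 / real (Suc j)) *\<^sub>R ((real (k n) *\<^sub>R b n - real j *\<^sub>R b n) ** (real (k n choose j) *\<^sub>R mpow (b n) j)))
      \<longlonglongrightarrow> (1 / real (Suc j)) *\<^sub>R ((X - real j *\<^sub>R 0) ** ((1 / fact j) *\<^sub>R mpow X j))"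
    by (intro tendsto_intros matmul.tendsto Suc b kb)
  moreover have "(1 / real (Suc j)) *\<^sub>R ((real (k n) *\<^sub>R b n - real j *\<^sub>R b n) ** (real (k n choose j) *\<^sub>R mpow (b n) j))
      = real (k n choose Suc j) *\<^sub>R mpow (b n) (Suc j)" for n
    unfolding choose mpow_Suc
    by (simp add: scaleR_diff_left[symmetric] matmul.scaleR_left matmul.scaleR_right mult_ac)
  moreover have "(1 / real (Suc j)) *\<^sub>R ((X - real j *\<^sub>R 0) ** ((1 / fact j) *\<^sub>R mpow X j))
      = (1 / fact (Suc j)) *\<^sub>R mpow X (Suc j)"
    by (simp add: mpow_Suc matmul.scaleR_right mult_ac)
  ultimately show ?case
    by simp
qed simp

text \<open>Tannery's theorem, dominated convergence for series, moves the limit inside the binomial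
  expansion. The dominating series is a multiple of that of \<open>exp M\<close>, where
  \<open>M\<close> bounds the norms of \<open>real (k n) *\<^sub>R b n\<close>.\<close>

lemma mpow_tendsto_mexp:
  fixes b :: "nat \<Rightarrow> 'n::finite cmatrix"
  assumes b: "b \<longlonglongrightarrow> 0" and kb: "(\<lambda>n. real (k n) *\<^sub>R b n) \<longlonglongrightarrow> X"
  shows "(\<lambda>n. mpow (mat 1 + b n) (k n)) \<longlonglongrightarrow> mexp X"
proof (intro vec_tendstoI)
  fix p q :: 'n
  let ?N = "norm (mat 1 :: 'n cmatrix)"
  obtain M where M: "\<And>n. norm (real (k n) *\<^sub>R b n) \<le> M"
    using convergent_imp_bounded[OF kb] unfolding bounded_iff by blast
  define a where "a j n = real (k n choose j) *\<^sub>R mpow (b n) j" for j n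
  have sums: "(\<lambda>k. M ^ k / fact k) sums exp M"
    using exp_converges[of M] by (simp add: field_simps)
  have bound: "norm (a j n $ p $ q) \<le> ?N * (M ^ j / fact j)" for j n
  proof -
    have "real (k n choose j) * fact j \<le> real (k n) ^ j"
      using binomial_fact_pow[of "k n" j] by (metis of_nat_fact of_nat_le_iff of_nat_mult of_nat_power)
    then have ch: "real (k n choose j) \<le> real (k n) ^ j / fact j"
      by (simp add: field_simps)
    have "norm (a j n $ p $ q) \<le> norm (a j n)"
      by (rule order_trans[OF Finite_Cartesian_Product.norm_nth_le Finite_Cartesian_Product.norm_nth_le])
    also have "\<dots> \<le> real (k n choose j) * (?N * norm (b n) ^ j)"
      using norm_mpow_le[of "b n" j] by (simp add: a_def mult_left_mono)
    also have "\<dots> \<le> (real (k n) ^ j / fact j) * (?N * norm (b n) ^ j)"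
      by (intro mult_right_mono ch) simp
    also have "\<dots> = ?N * (norm (real (k n) *\<^sub>R b n) ^ j / fact j)"
      by (simp add: power_mult_distrib)
    also have "\<dots> \<le> ?N * (M ^ j / fact j)"
      by (intro mult_left_mono divide_right_mono power_mono M) simp_all
    finally show ?thesis .
  qed
  have "(\<lambda>n. \<Sum>j. a j n $ p $ q) \<longlonglongrightarrow> (\<Sum>j. ((1 / fact j) *\<^sub>R mpow X j) $ p $ q)"
  proof (rule conjunct2[OF conjunct2[OF tannerys_theorem]])
    show "(\<lambda>n. a j n $ p $ q) \<longlonglongrightarrow> ((1 / fact j) *\<^sub>R mpow X j) $ p $ q" for j
      unfolding a_def by (intro tendsto_vec_nth choose_mpow_tendsto b kb)
    show "\<forall>\<^sub>F (j, n) in sequentially \<times>\<^sub>F sequentially. norm (a j n $ p $ q) \<le> ?N * (M ^ j / fact j)"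
      using bound by (intro always_eventually) auto
    show "summable (\<lambda>j. ?N * (M ^ j / fact j))"
      by (intro summable_mult sums_summable[OF sums])
  qed simp
  \<comment> \<open>The series is the finite binomial expansion, since
    \<open>k n choose j = 0\<close> for \<open>j > k n\<close>.\<close>
  moreover have "(\<Sum>j. a j n $ p $ q) = mpow (mat 1 + b n) (k n) $ p $ q" for n
    by (subst suminf_finite[of "{..k n}"]) (auto simp: a_def mpow_one_plus)
  moreover have "(\<Sum>j. ((1 / fact j) *\<^sub>R mpow X j) $ p $ q) = mexp X $ p $ q"
  proof -
    have "bounded_linear (\<lambda>A :: 'n cmatrix. A $ p $ q)"
      by (intro bounded_linear_compose[OF bounded_linear_vec_nth] bounded_linear_vec_nth)
    from bounded_linear.suminf[OF this summable_mexp[of X]] show ?thesis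
      by (simp add: mexp_def)
  qed
  ultimately show "(\<lambda>n. mpow (mat 1 + b n) (k n) $ p $ q) \<longlonglongrightarrow> mexp X $ p $ q"
    by simp
qed

section \<open>Second-order expansion and coercivity\<close>

lemma has_derivative_fderiv:
  assumes "f differentiable (at u)"
  shows "(f has_derivative blinfun_apply (fderiv f u)) (at u)"
proof -
  have "(f has_derivative frechet_derivative f (at u)) (at u)"
    using assms by (simp add: frechet_derivative_works)
  then show ?thesis
    unfolding fderiv_def by (simp add: bounded_linear_Blinfun_apply[OF has_derivative_bounded_linear])
qed

lemma fderiv_apply: "f differentiable (at u) \<Longrightarrow> blinfun_apply (fderiv f u) = D1 f u"
  unfolding D1_def by (rule frechet_derivative_at[OF has_derivative_fderiv])

lemma C2_second_order_expansion:
  fixes L :: "'e::real_normed_vector \<Rightarrow> real"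
  assumes "C2 L" "\<epsilon> > 0"
  shows "\<exists>\<delta>>0. \<forall>w. norm w < \<delta> \<longrightarrow>
           \<bar>L (u + w) - L u - D1 L u w - D2 L u w w / 2\<bar> \<le> \<epsilon> * (norm w)\<^sup>2"
proof -
  define B where "B = fderiv L"
  define A where "A = fderiv B u"
  have L': "(L has_derivative blinfun_apply (B x)) (at x)" for x
    using assms(1) has_derivative_fderiv unfolding C2_def B_def by blast
  have "(B has_derivative blinfun_apply A) (at u)"
    using assms(1) has_derivative_fderiv unfolding C2_def C1_on_def A_def B_def by blast
  then obtain \<delta> where \<delta>: "\<delta> > 0"
      "\<And>y. norm (y - u) < \<delta> \<Longrightarrow> norm (B y - B u - A (y - u)) \<le> \<epsilon> * norm (y - u)"
    using assms(2) unfolding has_derivative_at_alt by blast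
  have "\<bar>L (u + w) - L u - D1 L u w - D2 L u w w / 2\<bar> \<le> \<epsilon> * (norm w)\<^sup>2" if w: "norm w < \<delta>" for w
  proof -
    \<comment> \<open>\<open>h\<close> is \<open>L\<close> along the segment minus the first- and
      second-order Taylor terms. Its derivative is the error of the linearisation of
      \<open>B\<close> at \<open>u\<close>, evaluated on \<open>w\<close>, so the mean value theorem
      gives the bound.\<close>
    define h where "h t = L (u + t *\<^sub>R w) - t * B u w - t\<^sup>2 / 2 * A w w" for t
    have "DERIV h t :> B (u + t *\<^sub>R w) w - B u w - t * A w w" for t
    proof -
      have "((\<lambda>t. L (u + t *\<^sub>R w)) has_derivative (\<lambda>s. B (u + t *\<^sub>R w) (s *\<^sub>R w))) (at t)"
        by (rule has_derivative_compose[OF _ L', of "\<lambda>t. u + t *\<^sub>R w" "\<lambda>s. s *\<^sub>R w"])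
          (auto intro!: derivative_eq_intros)
      moreover have "(\<lambda>s. B (u + t *\<^sub>R w) (s *\<^sub>R w)) = (*) (B (u + t *\<^sub>R w) w)"
        by (simp add: fun_eq_iff blinfun.scaleR_right)
      ultimately have "((\<lambda>t. L (u + t *\<^sub>R w)) has_real_derivative B (u + t *\<^sub>R w) w) (at t)"
        by (simp add: has_field_derivative_def)
      then show ?thesis
        unfolding h_def by (auto intro!: derivative_eq_intros)
    qed
    then obtain t where t: "0 < t" "t < 1" "h 1 - h 0 = B (u + t *\<^sub>R w) w - B u w - t * A w w"
      using MVT2[of 0 1 h "\<lambda>t. B (u + t *\<^sub>R w) w - B u w - t * A w w"] by auto
    have tw: "norm (t *\<^sub>R w) \<le> norm w"
      using t by (simp add: mult_left_le_one_le)
    have "\<bar>h 1 - h 0\<bar> = norm ((B (u + t *\<^sub>R w) - B u - A (u + t *\<^sub>R w - u)) w)"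
      by (simp add: t blinfun.diff_left blinfun.scaleR_right blinfun.scaleR_left)
    also have "\<dots> \<le> norm (B (u + t *\<^sub>R w) - B u - A (u + t *\<^sub>R w - u)) * norm w"
      by (rule norm_blinfun)
    also have "\<dots> \<le> (\<epsilon> * norm (u + t *\<^sub>R w - u)) * norm w"
      by (intro mult_right_mono \<delta>) (use w tw in auto)
    also have "\<dots> \<le> (\<epsilon> * norm w) * norm w"
      using tw assms(2) by (intro mult_right_mono mult_left_mono) auto
    finally have "\<bar>h 1 - h 0\<bar> \<le> \<epsilon> * (norm w)\<^sup>2"
      by (simp add: power2_eq_square)
    moreover have "B u w = D1 L u w"
      using assms(1) fderiv_apply[of L u] unfolding C2_def B_def by simp
    moreover have "A w w = D2 L u w w"
      unfolding A_def B_def D2_def by simp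
    ultimately show ?thesis
      by (simp add: h_def algebra_simps)
  qed
  with \<delta>(1) show ?thesis
    by blast
qed

text \<open>If \<open>z\<close> is small relative to \<open>w\<close>, then \<open>w\<close> and
  \<open>w - z\<close> have almost the same norm, and their values under the quadratic form differ
  by a small multiple of \<open>(norm w)\<^sup>2\<close>.\<close>

lemma coercive_perturbation:
  fixes Q :: "'e::real_normed_vector \<Rightarrow>\<^sub>L 'e \<Rightarrow>\<^sub>L real"
  assumes "c > 0"
  shows "\<exists>\<kappa>>0. \<forall>w z. Q (w - z) (w - z) \<ge> c * (norm (w - z))\<^sup>2 \<longrightarrow> norm z \<le> \<kappa> * norm w \<longrightarrow>
           Q w w \<ge> c / 2 * (norm w)\<^sup>2"
proof -
  define M where "M = norm Q"
  have M: "M \<ge> 0"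
    by (simp add: M_def)
  have Q: "\<bar>Q x y\<bar> \<le> M * norm x * norm y" for x y
  proof -
    have "\<bar>Q x y\<bar> \<le> norm (Q x) * norm y"
      using norm_blinfun[of "Q x" y] by simp
    also have "\<dots> \<le> M * norm x * norm y"
      unfolding M_def by (intro mult_right_mono norm_blinfun) simp
    finally show ?thesis .
  qed
  \<comment> \<open>In units of \<open>(norm w)\<^sup>2\<close>, comparing the norms costs
    \<open>2 * c * \<kappa>\<close> and the three terms containing \<open>z\<close> cost at most
    \<open>5 * M * \<kappa>\<close>; the total is exactly \<open>c / 2\<close>.\<close>
  define \<kappa> where "\<kappa> = c / (4 * c + 10 * M)"
  have \<kappa>: "\<kappa> > 0" "\<kappa> \<le> 1" "(4 * c + 10 * M) * \<kappa> = c"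
    using assms M by (auto simp: \<kappa>_def field_simps)
  have "c / 2 * (norm w)\<^sup>2 \<le> Q w w"
    if co: "Q (w - z) (w - z) \<ge> c * (norm (w - z))\<^sup>2" and z: "norm z \<le> \<kappa> * norm w" for w z
  proof -
    define n where "n = norm w"
    have n: "n \<ge> 0" "norm z \<le> \<kappa> * n"
      using z by (simp_all add: n_def)
    have "\<kappa> * n \<le> n"
      using \<kappa> n by (simp add: mult_left_le_one_le)
    then have "norm (w - z) \<le> 2 * n" and low: "(1 - \<kappa>) * n \<le> norm (w - z)"
      using norm_triangle_ineq4[of w z] norm_triangle_ineq2[of w z] n
      unfolding n_def[symmetric] by (simp_all add: algebra_simps)
    have "(1 - 2 * \<kappa>) * n\<^sup>2 \<le> ((1 - \<kappa>) * n)\<^sup>2"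
      using \<kappa>(1) n(1) by (simp add: power2_eq_square algebra_simps)
    also have "\<dots> \<le> (norm (w - z))\<^sup>2"
      using low \<kappa> n by (intro power_mono) auto
    finally have sq: "c * ((1 - 2 * \<kappa>) * n\<^sup>2) \<le> Q (w - z) (w - z)"
      using co assms by (meson mult_left_mono order_trans less_imp_le)
    have Q': "\<bar>Q x y\<bar> \<le> M * r * s" if "norm x \<le> r" "norm y \<le> s" for x y r s
    proof -
      have "0 \<le> r"
        using that(1) norm_ge_zero[of x] by linarith
      then have "M * norm x * norm y \<le> M * r * s"
        using M that by (simp add: mult_mono mult_left_mono)
      with Q[of x y] show ?thesis
        by linarith
    qed
    have "norm z \<le> n"
      using n(2) \<open>\<kappa> * n \<le> n\<close> by linarith
    define p where "p = M * \<kappa> * n\<^sup>2"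
    have "\<bar>Q (w - z) z\<bar> \<le> 2 * p" "\<bar>Q z (w - z)\<bar> \<le> 2 * p" "\<bar>Q z z\<bar> \<le> p"
      using Q'[OF \<open>norm (w - z) \<le> 2 * n\<close> n(2)] Q'[OF n(2) \<open>norm (w - z) \<le> 2 * n\<close>]
        Q'[OF n(2) \<open>norm z \<le> n\<close>]
      by (simp_all add: p_def power2_eq_square mult_ac)
    moreover have "Q w w = Q (w - z) (w - z) + Q (w - z) z + Q z (w - z) + Q z z"
      by (simp add: blinfun.diff_left blinfun.diff_right)
    ultimately have "Q w w \<ge> c * ((1 - 2 * \<kappa>) * n\<^sup>2) - 5 * p"
      using sq unfolding abs_le_iff by linarith
    also have "c * ((1 - 2 * \<kappa>) * n\<^sup>2) - 5 * p = (c - (4 * c + 10 * M) * \<kappa> / 2) * n\<^sup>2"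
      by (simp add: p_def field_simps)
    also have "\<dots> = c / 2 * (norm w)\<^sup>2"
      by (simp add: \<kappa> n_def)
    finally show ?thesis .
  qed
  with \<kappa>(1) show ?thesis
    by blast
qed

lemma bounded_bilinear_scalar_product:
  assumes "continuous_scalar_product ip"
  shows "bounded_bilinear ip"
proof -
  have ip: "bilinear ip" "norm (ip v w) \<le> norm v * norm w * 1" for v w
    using assms by (auto simp: continuous_scalar_product_def)
  show ?thesis
    by (rule bounded_bilinear.intro)
      (use ip in \<open>auto simp only: bilinear_ladd bilinear_radd bilinear_lmul bilinear_rmul\<close>)
qed

text \<open>The right inverse takes values in the span of the gradients, hence in the orthogonal
  complement of any subset of the kernel; it exists because the Gram matrix of the gradients is
  invertible.\<close>

lemma gradient_right_inverse:
  fixes A :: "'e::real_normed_vector \<Rightarrow> real ^ 'm"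
  assumes ip: "continuous_scalar_product ip"
    and A: "surj A" "\<And>j w. A w $ j = ip (z j) w"
  shows "\<exists>R. bounded_linear R \<and> (\<forall>y. A (R y) = y) \<and> (\<forall>x y. A x = 0 \<longrightarrow> ip (R y) x = 0)"
proof -
  interpret ip: bounded_bilinear ip
    using ip by (rule bounded_bilinear_scalar_product)
  define T where "T a = (\<Sum>j\<in>UNIV. a $ j *\<^sub>R z j)" for a :: "real ^ 'm"
  have T: "linear T"
    by (intro linearI) (simp_all add: T_def scaleR_add_left sum.distrib scaleR_sum_right)
  have linA: "linear A"
    by (intro linearI) (simp_all add: vec_eq_iff A ip.add_right ip.scaleR_right)
  have ipT: "ip (T a) x = a \<bullet> A x" for a x
    by (simp add: T_def ip.sum_left ip.scaleR_left inner_vec_def A)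
  \<comment> \<open>\<open>A \<circ> T\<close> is the Gram matrix acting on coefficients. If it
    kills \<open>a\<close>, definiteness gives \<open>T a = 0\<close>; for \<open>x\<close> with
    \<open>A x = a\<close>, the square of the norm of \<open>a\<close> is then
    \<open>ip (T a) x = 0\<close>.\<close>
  have "inj (A \<circ> T)"
  proof (subst linear_injective_0[OF linear_compose[OF T linA]], intro allI impI)
    fix a
    assume "(A \<circ> T) a = 0"
    then have "ip (T a) (T a) = 0"
      by (simp add: ipT)
    then have "T a = 0"
      using ip unfolding continuous_scalar_product_def by (metis less_irrefl)
    moreover obtain x where "A x = a"
      using A(1) by (metis surjD)
    ultimately show "a = 0"
      using ipT[of a x] by (simp add: ip.zero_left)
  qed
  then obtain S where S: "linear S" "\<And>y. (A \<circ> T) (S y) = y"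
    using linear_injective_isomorphism[OF linear_compose[OF T linA]] by blast
  have "bounded_linear (T \<circ> S)"
    by (rule linear_conv_bounded_linear[THEN iffD1, OF linear_compose[OF S(1) T]])
  moreover have "ip ((T \<circ> S) y) x = 0" if "A x = 0" for x y
    using that by (simp add: ipT)
  ultimately show ?thesis
    using S(2) by (intro exI[of _ "T \<circ> S"]) auto
qed

text \<open>Since \<open>F v = F u\<close>, differentiability makes \<open>D1 F u (v - u)\<close>
  small relative to \<open>v - u\<close>. Subtracting its image under the right inverse leads into
  the kernel and preserves orthogonality to \<open>V\<close>, which lies in that kernel.\<close>

lemma coercive_on_slice:
  fixes L :: "'e::real_normed_vector \<Rightarrow> real" and F :: "'e \<Rightarrow> real ^ 'm"
  assumes ip: "continuous_scalar_product ip"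
    and L: "C2 L" "\<And>w. D1 L u w = 0"
    and F: "F differentiable (at u)" "surj (D1 F u)" "\<And>j w. D1 F u w $ j = ip (z j) w"
    and V: "V \<subseteq> tangent_level F u"
    and c: "c > 0" "\<And>w. w \<in> tangent_level F u \<inter> ortho_compl ip V \<Longrightarrow> D2 L u w w \<ge> c * (norm w)\<^sup>2"
  shows "\<exists>\<rho>>0. \<forall>v. F v = F u \<longrightarrow> v - u \<in> ortho_compl ip V \<longrightarrow> norm (v - u) < \<rho> \<longrightarrow>
           L v - L u \<ge> c / 8 * (norm (v - u))\<^sup>2"
proof -
  interpret ip: bounded_bilinear ip
    using ip by (rule bounded_bilinear_scalar_product)
  obtain R where R: "bounded_linear R" "\<And>y. D1 F u (R y) = y"
      "\<And>x y. D1 F u x = 0 \<Longrightarrow> ip (R y) x = 0"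
    using gradient_right_inverse[OF ip F(2) F(3)] by blast
  obtain K where K: "K > 0" "\<And>y. norm (R y) \<le> norm y * K"
    using bounded_linear.pos_bounded[OF R(1)] by blast
  obtain \<kappa> where \<kappa>: "\<kappa> > 0" "\<And>w z. D2 L u (w - z) (w - z) \<ge> c * (norm (w - z))\<^sup>2 \<Longrightarrow>
      norm z \<le> \<kappa> * norm w \<Longrightarrow> D2 L u w w \<ge> c / 2 * (norm w)\<^sup>2"
    using coercive_perturbation[OF c(1), of "fderiv (fderiv L) u"] unfolding D2_def by blast
  have F': "(F has_derivative D1 F u) (at u)"
    using F(1) unfolding D1_def frechet_derivative_works .
  then interpret F': bounded_linear "D1 F u"
    by (rule has_derivative_bounded_linear)
  \<comment> \<open>With accuracy \<open>\<kappa> / K\<close> in the linearisation of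
    \<open>F\<close>, the correction \<open>R (D1 F u w)\<close> has norm at most
    \<open>\<kappa> * norm w\<close>.\<close>
  have "\<kappa> / K > 0"
    using \<kappa> K by simp
  with F' obtain \<delta> where \<delta>: "\<delta> > 0"
      "\<And>y. norm (y - u) < \<delta> \<Longrightarrow> norm (F y - F u - D1 F u (y - u)) \<le> \<kappa> / K * norm (y - u)"
    unfolding has_derivative_at_alt by blast
  \<comment> \<open>The Taylor error \<open>c / 8\<close> uses up half of the coefficient
    \<open>c / 4\<close> that the term \<open>D2 L u w w / 2\<close> provides.\<close>
  obtain \<delta>' where \<delta>': "\<delta>' > 0"
      "\<And>w. norm w < \<delta>' \<Longrightarrow> \<bar>L (u + w) - L u - D1 L u w - D2 L u w w / 2\<bar> \<le> c / 8 * (norm w)\<^sup>2"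
    using C2_second_order_expansion[OF L(1), of "c / 8" u] c(1) by auto
  have "L v - L u \<ge> c / 8 * (norm (v - u))\<^sup>2"
    if v: "F v = F u" "v - u \<in> ortho_compl ip V" "norm (v - u) < min \<delta> \<delta>'" for v
  proof -
    define w where "w = v - u"
    define x where "x = R (D1 F u w)"
    have "norm (D1 F u w) \<le> \<kappa> / K * norm w"
      using \<delta>(2)[of v] v by (simp add: w_def)
    then have "norm x \<le> \<kappa> * norm w"
      using K(2)[of "D1 F u w"] K(1) unfolding x_def by (simp add: field_simps)
    moreover have "D1 F u (w - x) = 0"
      by (simp add: F'.diff x_def R)
    moreover have "w - x \<in> ortho_compl ip V"
      using v(2) V R(3) unfolding ortho_compl_def tangent_level_def w_def[symmetric] x_def
      by (auto simp: ip.diff_left)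
    ultimately have "D2 L u w w \<ge> c / 2 * (norm w)\<^sup>2"
      using c(2)[of "w - x"] \<kappa>(2) unfolding tangent_level_def by blast
    moreover have "\<bar>L v - L u - D2 L u w w / 2\<bar> \<le> c / 8 * (norm w)\<^sup>2"
      using \<delta>'(2)[of w] v(3) L(2) by (simp add: w_def)
    ultimately show ?thesis
      unfolding w_def by linarith
  qed
  then show ?thesis
    using \<delta>(1) \<delta>'(1) by (intro exI[of _ "min \<delta> \<delta>'"]) auto
qed

section \<open>Closed matrix groups\<close>

lemma matrix_Lie_groupD:
  assumes "matrix_Lie_group G"
  shows "mat 1 \<in> G" "g \<in> G \<Longrightarrow> h \<in> G \<Longrightarrow> g ** h \<in> G" "g \<in> G \<Longrightarrow> matrix_inv g \<in> G"
    "g \<in> G \<Longrightarrow> g ** matrix_inv g = mat 1" "g \<in> G \<Longrightarrow> matrix_inv g ** g = mat 1"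
  using assms closedin_subset[of "top_of_set {A. invertible A}" G]
  by (auto simp: matrix_Lie_group_def intro!: matrix_inv_mult)

lemma matrix_Lie_group_limit:
  assumes "matrix_Lie_group G" "\<And>n. s n \<in> G" "s \<longlonglongrightarrow> g" "invertible g"
  shows "g \<in> G"
proof -
  obtain T where T: "closed T" "G = {A. invertible A} \<inter> T"
    using assms(1) unfolding matrix_Lie_group_def closedin_closed by blast
  then have "g \<in> T"
    using assms(2,3) closed_sequentially by blast
  with T assms(4) show ?thesis
    by blast
qed

text \<open>Limits need checking only inside \<open>G\<close>: an invertible limit of elements of
  \<open>H\<close> already lies in \<open>G\<close>, which is closed among the invertible
  matrices.\<close>

lemma matrix_Lie_subgroupI:
  assumes G: "matrix_Lie_group G" and "H \<subseteq> G" "mat 1 \<in> H"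
    and "\<And>g h. g \<in> H \<Longrightarrow> h \<in> H \<Longrightarrow> g ** h \<in> H"
    and "\<And>g. g \<in> H \<Longrightarrow> matrix_inv g \<in> H"
    and limit: "\<And>s g. (\<And>n. s n \<in> H) \<Longrightarrow> s \<longlonglongrightarrow> g \<Longrightarrow> g \<in> G \<Longrightarrow> g \<in> H"
  shows "matrix_Lie_group H"
proof -
  have "closedin (top_of_set {A. invertible A}) H"
    unfolding closedin_limpt islimpt_sequential
  proof (intro conjI allI impI)
    show "H \<subseteq> {A. invertible A}"
      using assms(2) G closedin_subset unfolding matrix_Lie_group_def by fastforce
    fix g
    assume "(\<exists>s. (\<forall>n. s n \<in> H - {g}) \<and> s \<longlonglongrightarrow> g) \<and> g \<in> {A. invertible A}"
    then show "g \<in> H"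
      using limit matrix_Lie_group_limit[OF G] assms(2) by (metis Diff_iff mem_Collect_eq subsetD)
  qed
  then show ?thesis
    using assms by (auto simp: matrix_Lie_group_def)
qed

text \<open>Within a set of invertible matrices, relative closedness is as good as closedness. This
  gives the compactness for minimising over group elements.\<close>

lemma compact_matrix_Lie_group_Int:
  assumes G: "matrix_Lie_group G" and D: "compact D" "D \<subseteq> {A. invertible A}"
  shows "compact (G \<inter> D)"
proof -
  obtain T where "closed T" "G = {A. invertible A} \<inter> T"
    using G unfolding matrix_Lie_group_def closedin_closed by blast
  moreover have "G \<inter> D = T \<inter> D"
    using calculation D by blast
  ultimately show ?thesis
    using D by (simp add: closed_Int_compact)
qed

text \<open>Rounding \<open>t / x n\<close> down changes the product by at most
  \<open>x n\<close>.\<close>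

lemma floor_div_mult_tendsto:
  fixes x :: "nat \<Rightarrow> real"
  assumes "x \<longlonglongrightarrow> 0" "\<And>n. x n > 0" "t \<ge> 0"
  shows "(\<lambda>n. real (nat \<lfloor>t / x n\<rfloor>) * x n) \<longlonglongrightarrow> t"
proof (rule tendsto_sandwich)
  have "t - x n \<le> real (nat \<lfloor>t / x n\<rfloor>) * x n" "real (nat \<lfloor>t / x n\<rfloor>) * x n \<le> t" for n
  proof -
    have "real (nat \<lfloor>t / x n\<rfloor>) = of_int \<lfloor>t / x n\<rfloor>"
      using assms(2)[of n] assms(3) by simp
    moreover have "of_int \<lfloor>t / x n\<rfloor> * x n \<le> t / x n * x n"
      using assms(2)[of n] by (intro mult_right_mono of_int_floor_le) simp
    moreover have "(t / x n - 1) * x n \<le> of_int \<lfloor>t / x n\<rfloor> * x n"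
      using assms(2)[of n] by (intro mult_right_mono) (linarith, simp)
    ultimately show "t - x n \<le> real (nat \<lfloor>t / x n\<rfloor>) * x n" "real (nat \<lfloor>t / x n\<rfloor>) * x n \<le> t"
      using assms(2)[of n] by (simp_all add: left_diff_distrib)
  qed
  then show "\<forall>\<^sub>F n in sequentially. t - x n \<le> real (nat \<lfloor>t / x n\<rfloor>) * x n"
    "\<forall>\<^sub>F n in sequentially. real (nat \<lfloor>t / x n\<rfloor>) * x n \<le> t"
    by auto
  show "(\<lambda>n. t - x n) \<longlonglongrightarrow> t"
    using tendsto_diff[OF tendsto_const assms(1), of t] by simp
qed simp

text \<open>The identity \<open>diff\<close> serves twice: it bounds the inverses by
  \<open>2 * norm (mat 1)\<close> once \<open>s n\<close> is within \<open>1 / 2\<close> of the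
  identity, and with this bound it yields the convergence.\<close>

lemma matrix_inv_tendsto_one:
  fixes s :: "nat \<Rightarrow> 'n::finite cmatrix"
  assumes "s \<longlonglongrightarrow> mat 1" "\<And>n. invertible (s n)"
  shows "(\<lambda>n. matrix_inv (s n)) \<longlonglongrightarrow> mat 1"
proof -
  let ?N = "norm (mat 1 :: 'n cmatrix)"
  have "\<forall>\<^sub>F n in sequentially. norm (s n - mat 1) < 1 / 2"
    using tendstoD[OF assms(1), of "1 / 2"] by (simp add: dist_norm)
  then have "\<forall>\<^sub>F n in sequentially. norm (matrix_inv (s n) - mat 1) \<le> 2 * ?N * norm (s n - mat 1)"
  proof eventually_elim
    case (elim n)
    have diff: "matrix_inv (s n) - mat 1 = - ((s n - mat 1) ** matrix_inv (s n))"
      using matrix_inv_mult(1)[OF assms(2)[of n]] by (simp add: matmul.diff_left)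
    have le: "norm (matrix_inv (s n) - mat 1) \<le> norm (s n - mat 1) * norm (matrix_inv (s n))"
      unfolding diff norm_minus_cancel by (rule norm_matrix_mult_le)
    also have "\<dots> \<le> 1 / 2 * norm (matrix_inv (s n))"
      using elim by (intro mult_right_mono) auto
    finally have "norm (matrix_inv (s n)) \<le> 2 * ?N"
      using norm_triangle_ineq2[of "matrix_inv (s n)" "mat 1"] by simp
    then have "norm (s n - mat 1) * norm (matrix_inv (s n)) \<le> norm (s n - mat 1) * (2 * ?N)"
      by (rule mult_left_mono) simp
    with le show ?case
      by (simp add: mult_ac)
  qed
  moreover have "(\<lambda>n. 2 * ?N * norm (s n - mat 1)) \<longlonglongrightarrow> 0"
    using tendsto_mult_right_zero[OF tendsto_norm_zero[OF LIM_zero[OF assms(1)]], of "2 * ?N"] .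
  ultimately have "(\<lambda>n. matrix_inv (s n) - mat 1) \<longlonglongrightarrow> 0"
    by (rule Lim_null_comparison)
  then show ?thesis
    by (simp add: LIM_zero_iff)
qed

text \<open>Von Neumann's argument: if \<open>g\<^sub>n = 1 + a\<^sub>n\<close> tends to \<open>1\<close> in the group and
  \<open>a\<^sub>n / norm a\<^sub>n\<close> tends to \<open>\<zeta>\<close>, then the powers \<open>g\<^sub>n ^ k\<^sub>n\<close> with
  \<open>k\<^sub>n \<approx> t / norm a\<^sub>n\<close> tend to \<open>exp (t \<zeta>)\<close>.\<close>

lemma matrix_Lie_group_not_discrete:
  fixes S :: "'n::finite cmatrix set"
  assumes S: "matrix_Lie_group S" and lim: "mat 1 islimpt S"
  obtains \<zeta> where "\<zeta> \<noteq> 0" "\<zeta> \<in> Lie_algebra S"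
proof -
  obtain s0 where s0: "\<And>n. s0 n \<in> S - {mat 1}" "s0 \<longlonglongrightarrow> mat 1"
    using lim unfolding islimpt_sequential by blast
  \<comment> \<open>The directions of approach to the identity lie on the compact unit sphere, so a
    subsequence of them converges to a nonzero limit.\<close>
  have "seq_compact (sphere (0 :: 'n cmatrix) 1)"
    by (intro compact_imp_seq_compact) simp
  moreover have "\<forall>n. (1 / norm (s0 n - mat 1)) *\<^sub>R (s0 n - mat 1) \<in> sphere 0 1"
    using s0(1) by simp
  ultimately obtain \<zeta> r where \<zeta>: "\<zeta> \<in> sphere 0 1" "strict_mono r"
      "((\<lambda>n. (1 / norm (s0 n - mat 1)) *\<^sub>R (s0 n - mat 1)) \<circ> r) \<longlonglongrightarrow> \<zeta>"
    by (rule seq_compactE)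
  define s where "s = s0 \<circ> r"
  define a where "a n = s n - mat 1" for n
  define b where "b n = matrix_inv (s n) - mat 1" for n
  have s: "s n \<in> S" "a n \<noteq> 0" for n
    using s0(1)[of "r n"] by (auto simp: s_def a_def)
  have inv: "s n ** matrix_inv (s n) = mat 1" "matrix_inv (s n) ** s n = mat 1" for n
    using matrix_Lie_groupD(4,5)[OF S s(1)] by auto
  then have invertible: "invertible (s n)" for n
    unfolding invertible_def by blast
  have slim: "s \<longlonglongrightarrow> mat 1"
    unfolding s_def by (rule LIMSEQ_subseq_LIMSEQ[OF s0(2) \<zeta>(2)])
  then have a: "a \<longlonglongrightarrow> 0"
    unfolding a_def by (rule LIM_zero)
  have sinv: "(\<lambda>n. matrix_inv (s n)) \<longlonglongrightarrow> mat 1"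
    by (rule matrix_inv_tendsto_one[OF slim invertible])
  then have b: "b \<longlonglongrightarrow> 0"
    unfolding b_def by (rule LIM_zero)
  have dir: "(\<lambda>n. (1 / norm (a n)) *\<^sub>R a n) \<longlonglongrightarrow> \<zeta>"
    using \<zeta>(3) by (simp add: o_def a_def s_def)
  have mpow_S: "mpow g k \<in> S" if "g \<in> S" for g k
    by (induction k) (simp_all add: mpow_Suc matrix_Lie_groupD[OF S] that)
  \<comment> \<open>Negative times are reached through the inverses, whose deviations
    \<open>b n\<close> from the identity point asymptotically in the direction opposite to
    \<open>\<zeta>\<close>.\<close>
  have both: "mexp (t *\<^sub>R \<zeta>) \<in> S \<and> mexp (- t *\<^sub>R \<zeta>) \<in> S" if "t \<ge> 0" for t
  proof -
    define k where "k n = nat \<lfloor>t / norm (a n)\<rfloor>" for n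
    have "(\<lambda>n. real (k n) * norm (a n)) \<longlonglongrightarrow> t"
      unfolding k_def by (rule floor_div_mult_tendsto) (use a s that in \<open>auto intro: tendsto_norm_zero\<close>)
    from tendsto_scaleR[OF this dir] have ka: "(\<lambda>n. real (k n) *\<^sub>R a n) \<longlonglongrightarrow> t *\<^sub>R \<zeta>"
      using s(2) by simp
    have "real (k n) *\<^sub>R b n = - ((real (k n) *\<^sub>R a n) ** matrix_inv (s n))" for n
      by (simp add: a_def b_def matmul.diff_left matmul.scaleR_left inv algebra_simps)
    then have kb: "(\<lambda>n. real (k n) *\<^sub>R b n) \<longlonglongrightarrow> - t *\<^sub>R \<zeta>"
      using tendsto_minus[OF matmul.tendsto[OF ka sinv]] by simp
    have lima: "(\<lambda>n. mpow (s n) (k n)) \<longlonglongrightarrow> mexp (t *\<^sub>R \<zeta>)"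
      using mpow_tendsto_mexp[OF a ka] by (simp add: a_def)
    have limb: "(\<lambda>n. mpow (matrix_inv (s n)) (k n)) \<longlonglongrightarrow> mexp (- t *\<^sub>R \<zeta>)"
      using mpow_tendsto_mexp[OF b kb] by (simp add: b_def)
    \<comment> \<open>The two sequences of powers cancel termwise, so their limits are mutually
      inverse. Invertibility matters because \<open>S\<close> is closed only among the invertible
      matrices.\<close>
    have "mexp (t *\<^sub>R \<zeta>) ** mexp (- t *\<^sub>R \<zeta>) = mat 1"
      using matmul.tendsto[OF lima limb] unfolding mpow_mult_left_inverse[OF inv(1)]
      by (simp add: LIMSEQ_const_iff)
    moreover have "mexp (- t *\<^sub>R \<zeta>) ** mexp (t *\<^sub>R \<zeta>) = mat 1"
      using matmul.tendsto[OF limb lima] unfolding mpow_mult_left_inverse[OF inv(2)]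
      by (simp add: LIMSEQ_const_iff)
    ultimately have "invertible (mexp (t *\<^sub>R \<zeta>))" "invertible (mexp (- t *\<^sub>R \<zeta>))"
      unfolding invertible_def by blast+
    then show ?thesis
      using matrix_Lie_group_limit[OF S _ lima] matrix_Lie_group_limit[OF S _ limb] mpow_S s(1)
        matrix_Lie_groupD(3)[OF S] by blast
  qed
  have "mexp (t *\<^sub>R \<zeta>) \<in> S" for t
    using both[of t] both[of "- t"] by (cases "t \<ge> 0") auto
  then have "\<zeta> \<in> Lie_algebra S"
    by (simp add: Lie_algebra_def)
  moreover have "\<zeta> \<noteq> 0"
    using \<zeta>(1) by auto
  ultimately show thesis
    using that by blast
qed

section \<open>One-parameter subgroups and the curves they trace on orbits\<close>

lemma Lie_algebra_mono: "S \<subseteq> H \<Longrightarrow> Lie_algebra S \<subseteq> Lie_algebra H"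
  by (auto simp: Lie_algebra_def)

lemma Lie_algebra_scaleR: "\<xi> \<in> Lie_algebra H \<Longrightarrow> t *\<^sub>R \<xi> \<in> Lie_algebra H"
  by (simp add: Lie_algebra_def)

text \<open>\<open>generator\<close> is given by \<open>vector_derivative\<close>, which is
  meaningful only where a derivative exists. Near \<open>t = 0\<close> the curve is the exponential
  curve followed by a local \<open>C1_on\<close> extension of the orbit map, so the chain rule
  provides one.\<close>

lemma orbit_curve_has_vector_derivative:
  assumes "C1_vector G \<Phi> u" "mat 1 \<in> G" "\<xi> \<in> Lie_algebra G"
  shows "((\<lambda>t. \<Phi> (mexp (t *\<^sub>R \<xi>)) u) has_vector_derivative generator \<Phi> \<xi> u) (at 0)"
proof -
  have "\<exists>U f. open U \<and> mat 1 \<in> U \<and> C1_on U f \<and> (\<forall>h\<in>G \<inter> U. f h = \<Phi> h u)"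
    using assms(1,2) unfolding C1_vector_def by (rule bspec)
  then obtain U f where U: "open U" "mat 1 \<in> U" "C1_on U f" "\<forall>h\<in>G \<inter> U. f h = \<Phi> h u"
    by (elim exE conjE)
  let ?e = "\<lambda>t. mexp (t *\<^sub>R \<xi>)"
  obtain f' where f': "(f has_derivative f') (at (mat 1))"
    using U(2,3) unfolding C1_on_def differentiable_def by blast
  have e: "(?e has_derivative (\<lambda>t. t *\<^sub>R \<xi>)) (at 0)"
    using mexp_curve_has_vector_derivative unfolding has_vector_derivative_def .
  have "((\<lambda>t. f (?e t)) has_derivative (\<lambda>t. f' (t *\<^sub>R \<xi>))) (at 0)"
    by (rule has_derivative_compose[OF e]) (simp add: f')
  moreover have "f' (t *\<^sub>R \<xi>) = t *\<^sub>R f' \<xi>" for t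
    using has_derivative_bounded_linear[OF f'] by (simp add: linear_simps(5))
  ultimately have f: "((\<lambda>t. f (?e t)) has_vector_derivative f' \<xi>) (at 0)"
    by (simp add: has_vector_derivative_def)
  have "isCont ?e 0"
    using e by (rule has_derivative_continuous)
  then have "(?e \<longlongrightarrow> mat 1) (nhds 0)"
    by (simp add: continuous_at tendsto_nhds_iff)
  then have "\<forall>\<^sub>F t in nhds 0. ?e t \<in> U"
    using U(1,2) by (rule topological_tendstoD)
  then obtain T where T: "open T" "0 \<in> T" "\<And>t. t \<in> T \<Longrightarrow> ?e t \<in> U"
    unfolding eventually_nhds by blast
  have "((\<lambda>t. \<Phi> (?e t) u) has_vector_derivative f' \<xi>) (at 0)"
    by (rule has_vector_derivative_transform_within_open[OF f T(1,2)])
      (use U(4) T(3) assms(3) in \<open>auto simp: Lie_algebra_def\<close>)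
  then show ?thesis
    unfolding generator_def by (simp add: vector_derivative_at)
qed

section \<open>Isometric actions\<close>

locale isometric_action =
  fixes G :: "'n::finite cmatrix set" and \<Phi> :: "'n cmatrix \<Rightarrow> 'e::real_normed_vector \<Rightarrow> 'e"
  assumes G: "matrix_Lie_group G" and action: "Lie_action G \<Phi>"
    and linear_act: "g \<in> G \<Longrightarrow> linear (\<Phi> g)" and norm_act: "g \<in> G \<Longrightarrow> norm (\<Phi> g v) = norm v"
begin

lemma act_one: "\<Phi> (mat 1) u = u"
  using action by (simp add: Lie_action_def)

lemma act_mult: "g \<in> G \<Longrightarrow> h \<in> G \<Longrightarrow> \<Phi> (g ** h) u = \<Phi> g (\<Phi> h u)"
  using action by (simp add: Lie_action_def)

lemma act_inv: "g \<in> G \<Longrightarrow> \<Phi> (matrix_inv g) (\<Phi> g u) = u" "g \<in> G \<Longrightarrow> \<Phi> g (\<Phi> (matrix_inv g) u) = u"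
  using act_mult[symmetric] act_one by (simp_all add: matrix_Lie_groupD[OF G])

lemma act_diff: "g \<in> G \<Longrightarrow> \<Phi> g u - \<Phi> g v = \<Phi> g (u - v)"
  by (simp add: linear_act linear_diff)

lemma norm_act_inv_diff: "g \<in> G \<Longrightarrow> norm (\<Phi> (matrix_inv g) u - v) = norm (u - \<Phi> g v)"
  using act_diff[of g "\<Phi> (matrix_inv g) u" v] norm_act[of g "\<Phi> (matrix_inv g) u - v"] act_inv(2)[of g u]
  by simp

lemma act_tendsto:
  assumes "\<And>n. s n \<in> G" "s \<longlonglongrightarrow> g" "g \<in> G"
  shows "(\<lambda>n. \<Phi> (s n) u) \<longlonglongrightarrow> \<Phi> g u"
  using continuous_on_tendsto_compose[of G "\<lambda>g. \<Phi> g u" s g sequentially] assms action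
  by (simp add: Lie_action_def)

lemma set_stabilizer_subset: "set_stabilizer G \<Phi> S \<subseteq> G"
  by (auto simp: set_stabilizer_def)

lemma act_set_stabilizer: "g \<in> set_stabilizer G \<Phi> S \<Longrightarrow> u \<in> S \<Longrightarrow> \<Phi> g u \<in> S"
  by (auto simp: set_stabilizer_def)

text \<open>For a limit \<open>g\<close> of stabilizing elements, \<open>\<Phi> g\<close> maps the
  closed set \<open>S\<close> into itself by continuity. For the inverse, the isometry property
  turns the convergence of \<open>\<Phi> (s n) ?v\<close> to \<open>u = \<Phi> g ?v\<close> into
  that of \<open>\<Phi> (matrix_inv (s n)) u\<close> to \<open>?v\<close>.\<close>

lemma matrix_Lie_group_set_stabilizer:
  assumes "closed S"
  shows "matrix_Lie_group (set_stabilizer G \<Phi> S)" (is "matrix_Lie_group ?H")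
proof (rule matrix_Lie_subgroupI[OF G set_stabilizer_subset])
  show "mat 1 \<in> ?H"
    by (simp add: set_stabilizer_def matrix_Lie_groupD[OF G] act_one)
  show "g ** h \<in> ?H" if "g \<in> ?H" "h \<in> ?H" for g h
  proof -
    have "\<Phi> (g ** h) = \<Phi> g \<circ> \<Phi> h"
      using that by (simp add: fun_eq_iff act_mult set_stabilizer_def)
    then have "\<Phi> (g ** h) ` S = \<Phi> g ` (\<Phi> h ` S)"
      by (simp only: image_comp)
    also have "\<dots> = S"
      using that by (simp add: set_stabilizer_def)
    finally show ?thesis
      using that by (simp add: set_stabilizer_def matrix_Lie_groupD[OF G])
  qed
  show inv: "matrix_inv g \<in> ?H" if "g \<in> ?H" for g
  proof -
    have "g \<in> G" "\<Phi> g ` S = S"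
      using that by (auto simp: set_stabilizer_def)
    then have "\<Phi> (matrix_inv g) ` S = \<Phi> (matrix_inv g) ` (\<Phi> g ` S)"
      by (simp only:)
    also have "\<dots> = S"
      by (simp only: image_image act_inv(1)[OF \<open>g \<in> G\<close>] image_ident)
    finally show ?thesis
      using that by (simp add: set_stabilizer_def matrix_Lie_groupD[OF G])
  qed
  show "g \<in> ?H" if s: "\<And>n. s n \<in> ?H" "s \<longlonglongrightarrow> g" and g: "g \<in> G" for s g
  proof -
    have sG: "s n \<in> G" for n
      using s(1) set_stabilizer_subset by blast
    have fwd: "\<Phi> g u \<in> S" if "u \<in> S" for u
      using closed_sequentially[OF assms _ act_tendsto[OF sG s(2) g]] act_set_stabilizer[OF s(1) that] by blast
    have bwd: "\<Phi> (matrix_inv g) u \<in> S" if "u \<in> S" for u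
    proof -
      let ?v = "\<Phi> (matrix_inv g) u"
      have "(\<lambda>n. norm (u - \<Phi> (s n) ?v)) \<longlonglongrightarrow> norm (u - \<Phi> g ?v)"
        by (intro tendsto_intros act_tendsto[OF sG s(2) g])
      then have "(\<lambda>n. norm (\<Phi> (matrix_inv (s n)) u - ?v)) \<longlonglongrightarrow> 0"
        by (simp add: norm_act_inv_diff sG act_inv g)
      then have "(\<lambda>n. \<Phi> (matrix_inv (s n)) u) \<longlonglongrightarrow> ?v"
        by (simp add: LIM_zero_iff tendsto_norm_zero_iff)
      moreover have "\<Phi> (matrix_inv (s n)) u \<in> S" for n
        using act_set_stabilizer[OF inv[OF s(1)] that] .
      ultimately show ?thesis
        using closed_sequentially[OF assms, of "\<lambda>n. \<Phi> (matrix_inv (s n)) u"] by simp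
    qed
    have "S \<subseteq> \<Phi> g ` S"
      using bwd act_inv(2)[OF g] by (metis image_eqI subsetI)
    with fwd g show ?thesis
      by (auto simp: set_stabilizer_def)
  qed
qed

lemma matrix_Lie_group_isotropy:
  assumes H: "matrix_Lie_group H" and "H \<subseteq> G"
  shows "matrix_Lie_group {g \<in> H. \<Phi> g u = u}"
proof (rule matrix_Lie_subgroupI[OF H])
  show "matrix_inv g \<in> {g \<in> H. \<Phi> g u = u}" if "g \<in> {g \<in> H. \<Phi> g u = u}" for g
    using that assms act_inv(1)[of g u] by (auto simp: matrix_Lie_groupD[OF H])
  show "g \<in> {g \<in> H. \<Phi> g u = u}"
    if s: "\<And>n. s n \<in> {g \<in> H. \<Phi> g u = u}" "s \<longlonglongrightarrow> g" "g \<in> H" for s g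
  proof -
    have "(\<lambda>n. \<Phi> (s n) u) \<longlonglongrightarrow> \<Phi> g u"
      by (rule act_tendsto) (use s assms(2) in auto)
    with s show ?thesis
      by (simp add: LIMSEQ_const_iff)
  qed
qed (use assms(2) in \<open>auto simp: matrix_Lie_groupD[OF H] act_one act_mult subset_iff\<close>)

text \<open>If \<open>g\<close> minimises the scalar product distance from \<open>u'\<close> to the orbit near \<open>u\<close>, then the
  vanishing of the first variation is the orthogonality claimed for \<open>\<Phi> (matrix_inv g) u'\<close>. The
  minimum is not attained on the boundary because the isotropy group of \<open>u\<close> is discrete.\<close>

lemma orbit_slice:
  assumes ip: "continuous_scalar_product ip"
    and ip_act: "\<And>g v w. g \<in> G \<Longrightarrow> ip (\<Phi> g v) (\<Phi> g w) = ip v w"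
    and H: "matrix_Lie_group H" "H \<subseteq> G"
    and C1: "C1_vector G \<Phi> u"
    and inj: "open U" "0 \<in> U" "inj_on (\<lambda>\<xi>. \<Phi> (mexp \<xi>) u) (U \<inter> Lie_algebra H)"
    and "\<epsilon> > 0"
  shows "\<exists>\<eta>>0. \<forall>u'. dist u u' \<le> \<eta> \<longrightarrow> (\<exists>g\<in>H.
           \<Phi> (matrix_inv g) u' - u \<in> ortho_compl ip (tangent_orbit H \<Phi> u) \<and>
           norm (\<Phi> (matrix_inv g) u' - u) < \<epsilon>)"
proof -
  interpret ip: bounded_bilinear ip
    using ip by (rule bounded_bilinear_scalar_product)
  have sym: "ip v w = ip w v" and pos: "v \<noteq> 0 \<Longrightarrow> ip v v > 0" for v w
    using ip by (auto simp: continuous_scalar_product_def)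
  have nonneg: "ip v v \<ge> 0" for v
    using pos[of v] by (cases "v = 0") (auto simp: ip.zero_left)
  have le_norm: "ip v v \<le> (norm v)\<^sup>2" for v
    using ip by (auto simp: continuous_scalar_product_def power2_eq_square abs_le_iff)
  define S where "S = {g \<in> H. \<Phi> g u = u}"
  have S: "matrix_Lie_group S"
    unfolding S_def by (rule matrix_Lie_group_isotropy[OF H])
  have "\<not> mat 1 islimpt S"
  proof
    assume "mat 1 islimpt S"
    then obtain \<zeta> where \<zeta>: "\<zeta> \<noteq> 0" "\<zeta> \<in> Lie_algebra S"
      using matrix_Lie_group_not_discrete[OF S] by blast
    obtain d where d: "d > 0" "ball 0 d \<subseteq> U"
      using inj(1,2) open_contains_ball by blast
    define t where "t = d / (2 * norm \<zeta>)"
    have "t > 0" "norm (t *\<^sub>R \<zeta>) < d"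
      using d(1) \<zeta>(1) by (simp_all add: t_def)
    then have "t *\<^sub>R \<zeta> \<in> U" "t *\<^sub>R \<zeta> \<noteq> 0"
      using d(2) \<zeta>(1) by auto
    moreover have "Lie_algebra S \<subseteq> Lie_algebra H"
      by (rule Lie_algebra_mono) (auto simp: S_def)
    moreover have "t *\<^sub>R \<zeta> \<in> Lie_algebra S" "0 \<in> Lie_algebra S"
      using Lie_algebra_scaleR[OF \<zeta>(2)] Lie_algebra_scaleR[OF \<zeta>(2), of 0] by simp_all
    moreover have "\<Phi> (mexp (t *\<^sub>R \<zeta>)) u = u" "\<Phi> (mexp 0) u = u"
      using \<zeta>(2) act_one by (auto simp: Lie_algebra_def S_def)
    ultimately show False
      using inj_onD[OF inj(3), of "t *\<^sub>R \<zeta>" 0] inj(2) by auto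
  qed
  then obtain r0 where r0: "r0 > 0" "\<And>g. g \<in> S \<Longrightarrow> dist g (mat 1) < r0 \<Longrightarrow> g = mat 1"
    unfolding islimpt_approachable by blast
  have contG: "continuous_on G (\<lambda>g. \<Phi> g v)" for v
    using action by (simp add: Lie_action_def)
  have one: "mat 1 \<in> G"
    using matrix_Lie_groupD(1)[OF G] .
  obtain r1 where r1: "r1 > 0" "\<And>g. g \<in> G \<Longrightarrow> dist g (mat 1) < r1 \<Longrightarrow> dist (\<Phi> g u) u < \<epsilon> / 2"
    using contG[of u, unfolded continuous_on_iff, rule_format, OF one, of "\<epsilon> / 2"] \<open>\<epsilon> > 0\<close>
    by (auto simp: act_one)
  \<comment> \<open>\<open>r < r0\<close> leaves \<open>mat 1\<close> as the only isotropy element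
    in the closed ball, \<open>r < r1\<close> keeps the orbit points within
    \<open>\<epsilon> / 2\<close> of \<open>u\<close>, and \<open>r < 1\<close> makes the ball
    consist of invertible matrices.\<close>
  define r where "r = min r0 (min r1 1) / 2"
  have r: "r > 0" "r < r0" "r < r1" "r < 1"
    using r0(1) r1(1) by (auto simp: r_def)
  have ball_inv: "cball (mat 1) r \<subseteq> {A :: 'n cmatrix. invertible A}"
    using r(4) by (auto intro!: invertible_near_one simp: dist_norm norm_minus_commute)
  define N where "N = H \<inter> cball (mat 1) r"
  define K where "K = H \<inter> sphere (mat 1) r"
  have "compact N" "compact K"
    unfolding N_def K_def
    by (rule compact_matrix_Lie_group_Int[OF H(1)]; use ball_inv in force)+
  have cont: "continuous_on X (\<lambda>g. ip (\<Phi> g u - v) (\<Phi> g u - v))" if "X \<subseteq> H" for X v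
    by (intro ip.continuous_on continuous_intros continuous_on_subset[OF contG] order_trans[OF that H(2)])
  \<comment> \<open>No element of \<open>K\<close> fixes \<open>u\<close>, so the squared scalar
    product distance has a positive minimum on \<open>K\<close>; if \<open>K\<close> is empty, any
    positive number will do.\<close>
  obtain \<delta> where \<delta>: "\<delta> > 0" "\<And>g. g \<in> K \<Longrightarrow> ip (\<Phi> g u - u) (\<Phi> g u - u) \<ge> \<delta>"
  proof (cases "K = {}")
    case False
    have "K \<subseteq> H"
      by (simp add: K_def)
    then obtain g0 where g0: "g0 \<in> K" "\<And>g. g \<in> K \<Longrightarrow> ip (\<Phi> g0 u - u) (\<Phi> g0 u - u) \<le> ip (\<Phi> g u - u) (\<Phi> g u - u)"
      using continuous_attains_inf[OF \<open>compact K\<close> False cont] by blast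
    have "\<Phi> g0 u \<noteq> u"
      using r0(2)[of g0] g0(1) r by (auto simp: S_def K_def dist_commute)
    then show thesis
      using that[of "ip (\<Phi> g0 u - u) (\<Phi> g0 u - u)"] pos[of "\<Phi> g0 u - u"] g0(2) by simp
  qed (use that[of 1] in auto)
  \<comment> \<open>The first bound serves the final norm estimate; the second gives
    \<open>4 * \<eta>\<^sup>2 < \<delta>\<close>, which excludes minimisers on
    \<open>K\<close>.\<close>
  define \<eta> where "\<eta> = min (\<epsilon> / 2) (sqrt \<delta> / 3)"
  have \<eta>: "\<eta> > 0" "\<eta> \<le> \<epsilon> / 2"
    using \<open>\<epsilon> > 0\<close> \<delta>(1) by (auto simp: \<eta>_def)
  have "\<eta>\<^sup>2 \<le> (sqrt \<delta> / 3)\<^sup>2"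
    using \<eta>(1) by (intro power_mono) (auto simp: \<eta>_def)
  then have \<eta>\<delta>: "4 * \<eta>\<^sup>2 < \<delta>"
    using \<delta>(1) by (simp add: power_divide)
  have "\<exists>g\<in>H. \<Phi> (matrix_inv g) u' - u \<in> ortho_compl ip (tangent_orbit H \<Phi> u) \<and>
           norm (\<Phi> (matrix_inv g) u' - u) < \<epsilon>" if u': "dist u u' \<le> \<eta>" for u'
  proof -
    define q where "q g = ip (\<Phi> g u - u') (\<Phi> g u - u')" for g
    have q1: "q (mat 1) \<le> \<eta>\<^sup>2"
      using le_norm[of "u - u'"] power_mono[of "norm (u - u')" \<eta> 2] u' by (simp add: q_def act_one dist_norm)
    have "mat 1 \<in> N" "N \<subseteq> H"
      using matrix_Lie_groupD(1)[OF H(1)] r(1) by (auto simp: N_def)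
    then obtain g where g: "g \<in> N" "\<And>h. h \<in> N \<Longrightarrow> q g \<le> q h"
      using continuous_attains_inf[OF \<open>compact N\<close> _ cont, of u'] unfolding q_def by blast
    have gH: "g \<in> H" and gG: "g \<in> G"
      using g(1) H(2) by (auto simp: N_def)
    have "g \<notin> K"
    proof
      assume "g \<in> K"
      \<comment> \<open>This is the parallelogram identity for \<open>\<Phi> g u - u'\<close> and
        \<open>u - u'\<close>, with the square of their sum dropped.\<close>
      have "ip (\<Phi> g u - u) (\<Phi> g u - u) \<le> 2 * q g + 2 * ip (u - u') (u - u')"
        using nonneg[of "\<Phi> g u - u' + (u - u')"]
        by (simp add: q_def ip.add_left ip.add_right ip.diff_left ip.diff_right sym algebra_simps)
      also have "\<dots> \<le> 4 * \<eta>\<^sup>2"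
        using g(2)[OF \<open>mat 1 \<in> N\<close>] q1 by (simp add: q_def act_one)
      finally show False
        using \<delta>(2)[OF \<open>g \<in> K\<close>] \<eta>\<delta> by linarith
    qed
    then have gr: "dist (mat 1) g < r"
      using g(1) by (auto simp: N_def K_def)
    let ?v = "\<Phi> (matrix_inv g) u'"
    \<comment> \<open>Minimality of \<open>q g\<close> controls only the scalar product distance,
      which need not dominate the norm; the norm bound comes from \<open>g\<close> being close to
      the identity.\<close>
    have "norm (?v - u) = norm (u' - \<Phi> g u)"
      by (rule norm_act_inv_diff[OF gG])
    also have "\<dots> \<le> dist u u' + dist (\<Phi> g u) u"
      by (metis dist_commute dist_norm dist_triangle2 add.commute)
    also have "\<dots> < \<epsilon>"
      using r1(2)[OF gG] gr r(3) u' \<eta>(2) by (simp add: dist_commute)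
    finally have "norm (?v - u) < \<epsilon>" .
    moreover have "ip (?v - u) (generator \<Phi> \<xi> u) = 0" if \<xi>: "\<xi> \<in> Lie_algebra H" for \<xi>
    proof -
      let ?e = "\<lambda>t. mexp (t *\<^sub>R \<xi>)"
      let ?X = "generator \<Phi> \<xi> u"
      have eH: "?e t \<in> H" for t
        using \<xi> by (simp add: Lie_algebra_def)
      have "\<xi> \<in> Lie_algebra G"
        using \<xi> Lie_algebra_mono[OF H(2)] by blast
      from orbit_curve_has_vector_derivative[OF C1 one this]
      have "((\<lambda>t. \<Phi> (?e t) u - ?v) has_vector_derivative ?X) (at 0)"
        by (auto intro!: derivative_eq_intros)
      from ip.has_vector_derivative[OF this this]
      have "DERIV (\<lambda>t. ip (\<Phi> (?e t) u - ?v) (\<Phi> (?e t) u - ?v)) 0 :> ip (u - ?v) ?X + ip ?X (u - ?v)"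
        by (simp add: has_real_derivative_iff_has_vector_derivative act_one)
      \<comment> \<open>By invariance of \<open>ip\<close>, moving by \<open>\<Phi> g\<close> turns
        the variation of \<open>u\<close> seen from \<open>?v\<close> into a variation of
        \<open>q\<close> at its minimiser \<open>g\<close>.\<close>
      moreover have qe: "ip (\<Phi> (?e t) u - ?v) (\<Phi> (?e t) u - ?v) = q (g ** ?e t)" for t
      proof -
        have "\<Phi> (g ** ?e t) u - u' = \<Phi> g (\<Phi> (?e t) u - ?v)"
          using gG eH H(2) by (simp add: act_mult act_diff[symmetric] act_inv subset_iff)
        then show ?thesis
          unfolding q_def using ip_act[OF gG] by simp
      qed
      \<comment> \<open>Since \<open>g\<close> lies in the open ball, \<open>g ** ?e t\<close> stays
        in \<open>N\<close> for small \<open>t\<close>, so \<open>t = 0\<close> is a local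
        minimum.\<close>
      have "isCont (\<lambda>t. g ** ?e t) 0"
        using has_vector_derivative_continuous[OF mexp_curve_has_vector_derivative[of \<xi>]]
        by (intro matmul.isCont continuous_const)
      then obtain d where d: "d > 0" "\<And>t. dist t 0 < d \<Longrightarrow> dist (g ** ?e t) g < r - dist (mat 1) g"
        using gr unfolding continuous_at_eps_delta
        by (metis diff_gt_0_iff_gt matrix_mul_rid mexp_0 scale_zero_left)
      have "q (g ** ?e 0) \<le> q (g ** ?e t)" if "\<bar>0 - t\<bar> < d" for t
      proof -
        have "dist (mat 1) (g ** ?e t) \<le> r"
          using d(2)[of t] that dist_triangle[of "mat 1" "g ** ?e t" g] by (simp add: dist_commute)
        then have "g ** ?e t \<in> N"
          using matrix_Lie_groupD(2)[OF H(1) gH eH] by (simp add: N_def)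
        then show ?thesis
          using g(2) by simp
      qed
      ultimately have "ip (u - ?v) ?X + ip ?X (u - ?v) = 0"
        using d(1) unfolding qe by (intro DERIV_local_min[of "\<lambda>t. q (g ** ?e t)" _ 0 d]) auto
      then show ?thesis
        using sym[of ?X] by (simp add: ip.diff_left)
    qed
    ultimately show ?thesis
      using gH by (auto simp: ortho_compl_def tangent_orbit_def)
  qed
  with \<eta>(1) show ?thesis
    by blast
qed

end

text \<open>\<open>F\<close> is constant along the curves that define the tangent vectors of the
  orbit; the chain rule at \<open>t = 0\<close> gives the claim.\<close>

lemma tangent_orbit_subset_tangent_level:
  assumes "C1_vector G \<Phi> u" "mat 1 \<in> G" "H \<subseteq> G" "\<Phi> (mat 1) u = u"
    and F: "F differentiable (at u)" "\<And>g. g \<in> H \<Longrightarrow> F (\<Phi> g u) = F u"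
  shows "tangent_orbit H \<Phi> u \<subseteq> tangent_level F u"
proof
  fix y
  assume "y \<in> tangent_orbit H \<Phi> u"
  then obtain \<xi> where \<xi>: "\<xi> \<in> Lie_algebra H" "y = generator \<Phi> \<xi> u"
    by (auto simp: tangent_orbit_def)
  let ?p = "\<lambda>t. \<Phi> (mexp (t *\<^sub>R \<xi>)) u"
  have "(?p has_vector_derivative y) (at 0)"
    using orbit_curve_has_vector_derivative[OF assms(1,2)] \<xi> Lie_algebra_mono[OF assms(3)] by blast
  then have p: "(?p has_derivative (\<lambda>t. t *\<^sub>R y)) (at 0)"
    by (simp add: has_vector_derivative_def)
  have "(F has_derivative D1 F u) (at (?p 0))"
    using F(1) assms(4) by (simp add: D1_def frechet_derivative_works)
  from has_derivative_compose[OF p this]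
  have "((\<lambda>t. F (?p t)) has_derivative (\<lambda>t. D1 F u (t *\<^sub>R y))) (at 0)" .
  moreover have "(\<lambda>t. F (?p t)) = (\<lambda>t. F u)"
    using \<xi>(1) F(2) by (auto simp: Lie_algebra_def)
  ultimately have "(\<lambda>t. D1 F u (t *\<^sub>R y)) = (\<lambda>t. 0)"
    using has_derivative_unique has_derivative_const by metis
  from fun_cong[OF this, of 1] show "y \<in> tangent_level F u"
    by (simp add: tangent_level_def)
qed

lemma D1_vec_nth:
  assumes "F differentiable (at u)"
  shows "D1 (\<lambda>v. F v $ j) u w = D1 F u w $ j"
proof -
  have "((\<lambda>v. F v $ j) has_derivative (\<lambda>w. D1 F u w $ j)) (at u)"
    using assms unfolding D1_def frechet_derivative_works
    by (rule bounded_linear.has_derivative[OF bounded_linear_vec_nth])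
  then show ?thesis
    unfolding D1_def[of "\<lambda>v. F v $ j"] by (metis frechet_derivative_at)
qed

theorem proposition8p8:
  fixes ip :: "'e::banach \<Rightarrow> 'e \<Rightarrow> real"
    and G H :: "'n::finite cmatrix set"
    and \<Phi> :: "'n cmatrix \<Rightarrow> 'e \<Rightarrow> 'e"
    and F :: "'e \<Rightarrow> real ^ 'm"
    and \<mu> :: "real ^ 'm"
    and \<Sigma> Orb :: "'e set"
    and u\<mu> :: 'e
    and L :: "'e \<Rightarrow> real"
  assumes "continuous_scalar_product ip"
    and "matrix_Lie_group G"
    and "Lie_action G \<Phi>"
    and "C2 F"
    and \<Sigma>: "\<Sigma> = {u. F u = \<mu>}"
    and "u\<mu> \<in> \<Sigma>"
    and H: "H = set_stabilizer G \<Phi> \<Sigma>"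
    and Orb: "Orb = group_orbit H \<Phi> u\<mu>"
    and "C2 L"
    and L_invariant: "\<forall>g\<in>H. \<forall>u. L (\<Phi> g u) = L u"
    and Ci: "\<forall>g\<in>G. linear (\<Phi> g) \<and> (\<forall>v w. ip (\<Phi> g v) (\<Phi> g w) = ip v w) \<and>
              (\<forall>v. norm (\<Phi> g v) = norm v)"
    and Cii: "coAd_orthogonal G H"
    and Ciii: "regular_value F \<mu>"
    and Civ: "C1_vector G \<Phi> u\<mu>"
             "\<exists>U. open U \<and> 0 \<in> U \<and> inj_on (\<lambda>\<xi>. \<Phi> (mexp \<xi>) u\<mu>) (U \<inter> Lie_algebra H)"
    and gradients: "\<forall>u\<in>Orb. \<forall>j. \<exists>z. \<forall>w. D1 (\<lambda>v. F v $ j) u w = ip z w"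
    and a: "\<forall>u\<in>Orb. \<forall>w. D1 L u w = 0"
    and b: "\<exists>C>0. \<forall>u\<in>Orb. \<forall>w. D2 L u w w \<le> C * (norm w)\<^sup>2"
    and c: "\<exists>c>0. \<forall>u\<in>Orb. \<forall>w \<in> tangent_level F u \<inter> ortho_compl ip (tangent_orbit H \<Phi> u).
              D2 L u w w \<ge> c * (norm w)\<^sup>2"
  shows "\<exists>\<eta>>0. \<exists>c'>0. \<forall>u\<in>Orb. \<forall>u'\<in>\<Sigma>.
           dist u u' \<le> \<eta> \<longrightarrow> L u' - L u \<ge> c' * (infdist u' Orb)\<^sup>2"
proof -
  interpret isometric_action G \<Phi>
    by (rule isometric_action.intro) (use assms(2,3) Ci in simp_all)
  have F_diff: "F differentiable (at v)" for v
    using \<open>C2 F\<close> by (simp add: C2_def)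
  \<comment> \<open>Closedness of the level set makes its stabilizer \<open>H\<close> a matrix Lie
    group.\<close>
  have "closed \<Sigma>"
  proof -
    have "closed (F -` {\<mu>})"
      by (rule continuous_closed_vimage) (auto intro: differentiable_imp_continuous_within F_diff)
    then show ?thesis
      by (simp add: \<Sigma> vimage_def)
  qed
  have HL: "matrix_Lie_group H" and HG: "H \<subseteq> G"
    unfolding H using matrix_Lie_group_set_stabilizer[OF \<open>closed \<Sigma>\<close>] set_stabilizer_subset by auto
  have act_\<Sigma>: "\<Phi> g v \<in> \<Sigma>" if "g \<in> H" "v \<in> \<Sigma>" for g v
    using act_set_stabilizer that unfolding H by blast
  have Orb_mem: "\<Phi> g u\<mu> \<in> Orb" if "g \<in> H" for g
    using that by (auto simp: Orb group_orbit_def)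
  have u\<mu>_Orb: "u\<mu> \<in> Orb"
    using Orb_mem[OF matrix_Lie_groupD(1)[OF HL]] by (simp add: act_one)
  have "\<forall>j. \<exists>z. \<forall>w. D1 F u\<mu> w $ j = ip z w"
    using gradients u\<mu>_Orb by (simp add: D1_vec_nth F_diff)
  then obtain z where z: "\<And>j w. D1 F u\<mu> w $ j = ip (z j) w"
    by metis
  have surj: "surj (D1 F u\<mu>)"
    using Ciii \<open>u\<mu> \<in> \<Sigma>\<close> by (simp add: regular_value_def \<Sigma>)
  have tangent: "tangent_orbit H \<Phi> u\<mu> \<subseteq> tangent_level F u\<mu>"
    by (rule tangent_orbit_subset_tangent_level[OF Civ(1) matrix_Lie_groupD(1)[OF G] HG act_one F_diff])
      (use act_\<Sigma> \<open>u\<mu> \<in> \<Sigma>\<close> in \<open>simp add: \<Sigma>\<close>)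
  obtain \<gamma> where \<gamma>: "\<gamma> > 0" "\<And>w. w \<in> tangent_level F u\<mu> \<inter> ortho_compl ip (tangent_orbit H \<Phi> u\<mu>)
      \<Longrightarrow> D2 L u\<mu> w w \<ge> \<gamma> * (norm w)\<^sup>2"
    using c u\<mu>_Orb by blast
  have "\<And>w. D1 L u\<mu> w = 0"
    using a u\<mu>_Orb by blast
  from coercive_on_slice[OF assms(1) \<open>C2 L\<close> this F_diff surj z tangent \<gamma>]
  obtain \<rho> where \<rho>: "\<rho> > 0" "\<And>v. F v = F u\<mu> \<Longrightarrow> v - u\<mu> \<in> ortho_compl ip (tangent_orbit H \<Phi> u\<mu>) \<Longrightarrow>
      norm (v - u\<mu>) < \<rho> \<Longrightarrow> L v - L u\<mu> \<ge> \<gamma> / 8 * (norm (v - u\<mu>))\<^sup>2"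
    by blast
  obtain U where U: "open U" "0 \<in> U" "inj_on (\<lambda>\<xi>. \<Phi> (mexp \<xi>) u\<mu>) (U \<inter> Lie_algebra H)"
    using Civ(2) by blast
  have ip_act: "ip (\<Phi> g v) (\<Phi> g w) = ip v w" if "g \<in> G" for g v w
    using Ci that by blast
  obtain \<eta> where \<eta>: "\<eta> > 0" "\<And>u'. dist u\<mu> u' \<le> \<eta> \<Longrightarrow> \<exists>g\<in>H.
      \<Phi> (matrix_inv g) u' - u\<mu> \<in> ortho_compl ip (tangent_orbit H \<Phi> u\<mu>) \<and>
      norm (\<Phi> (matrix_inv g) u' - u\<mu>) < \<rho>"
    using orbit_slice[OF assms(1) ip_act HL HG Civ(1) U \<rho>(1)] by blast
  have "L u' - L u \<ge> \<gamma> / 8 * (infdist u' Orb)\<^sup>2"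
    if u: "u \<in> Orb" and u': "u' \<in> \<Sigma>" and dist: "dist u u' \<le> \<eta>" for u u'
  proof -
    obtain h where h: "h \<in> H" "u = \<Phi> h u\<mu>"
      using u by (auto simp: Orb group_orbit_def)
    \<comment> \<open>The isometry \<open>\<Phi> (matrix_inv h)\<close> carries \<open>u\<close> to
      the base point, so the radius found there serves the whole orbit.\<close>
    define v where "v = \<Phi> (matrix_inv h) u'"
    have "dist u\<mu> v = dist u u'"
      using norm_act_inv_diff[of h u' u\<mu>] h HG unfolding v_def
      by (metis dist_commute dist_norm subsetD)
    then obtain g where g: "g \<in> H" "\<Phi> (matrix_inv g) v - u\<mu> \<in> ortho_compl ip (tangent_orbit H \<Phi> u\<mu>)"
        "norm (\<Phi> (matrix_inv g) v - u\<mu>) < \<rho>"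
      using \<eta>(2)[of v] dist by auto
    define w where "w = \<Phi> (matrix_inv g) v"
    have inv: "matrix_inv h \<in> H" "matrix_inv g \<in> H"
      using matrix_Lie_groupD(3)[OF HL] h(1) g(1) by blast+
    then have "w \<in> \<Sigma>"
      unfolding w_def v_def by (intro act_\<Sigma> u')
    then have "\<gamma> / 8 * (norm (w - u\<mu>))\<^sup>2 \<le> L w - L u\<mu>"
      using g \<rho>(2)[of w] \<open>u\<mu> \<in> \<Sigma>\<close> by (simp add: \<Sigma> w_def)
    also have "L w - L u\<mu> = L u' - L u"
      using inv h L_invariant by (simp add: w_def v_def)
    finally have "\<gamma> / 8 * (norm (w - u\<mu>))\<^sup>2 \<le> L u' - L u" .
    moreover have "infdist u' Orb \<le> norm (w - u\<mu>)"
    proof -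
      have gh: "g \<in> G" "h \<in> G"
        using g(1) h(1) HG by auto
      \<comment> \<open>Undoing both motions sends \<open>w\<close> back to \<open>u'\<close> and
        \<open>u\<mu>\<close> to a point of the orbit, at unchanged distance.\<close>
      have "norm (w - u\<mu>) = norm (u' - \<Phi> h (\<Phi> g u\<mu>))"
        using gh by (simp add: w_def v_def norm_act_inv_diff)
      also have "\<dots> = dist u' (\<Phi> (h ** g) u\<mu>)"
        using gh by (simp add: act_mult dist_norm)
      finally show ?thesis
        using infdist_le[OF Orb_mem[OF matrix_Lie_groupD(2)[OF HL h(1) g(1)]]] by simp
    qed
    then have "\<gamma> / 8 * (infdist u' Orb)\<^sup>2 \<le> \<gamma> / 8 * (norm (w - u\<mu>))\<^sup>2"
      using \<gamma>(1) by (intro mult_left_mono power_mono infdist_nonneg) auto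
    ultimately show ?thesis
      by linarith
  qed
  with \<eta>(1) \<gamma>(1) show ?thesis
    by (intro exI[of _ \<eta>] conjI exI[of _ "\<gamma> / 8"]) auto
qed

end
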